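(* Let $\mathfrak{A}$ be a $2$-category and let $(\mathcal{A},\mathfrak{a}):\Delta_3\to\mathfrak{A}$ be a pseudofunctor whose lax descent object $\mathrm{lax}\text{-}\mathrm{Desc}(\mathcal{A})$ exists, with forgetful morphism $\mathsf{d}^{\mathcal{A}}:\mathrm{lax}\text{-}\mathrm{Desc}(\mathcal{A})\to\mathcal{A}(\mathsf{1})$. Let $J:\mathtt{S}\to\mathrm{lax}\text{-}\mathrm{Desc}(\mathcal{A})$ and $H:\mathtt{S}\to\mathtt{B}$ be morphisms of $\mathfrak{A}$. Then: (i) The forgetful morphism $\mathsf{d}^{\mathcal{A}}$ creates the right Kan extension of $\mathsf{d}^{\mathcal{A}}J$ along $H$, provided that $\mathrm{Ran}_H(\mathsf{d}^{\mathcal{A}}J)$ exists and is preserved by $\mathcal{A}(d^0)$ and by $\mathcal{A}(D^0)\cdot\mathcal{A}(d^0)$. (ii) Codually, the forgetful morphism $\mathsf{d}^{\mathcal{A}}$ creates the left Kan extension of $\mathsf{d}^{\mathcal{A}}J$ along $H$, provided that $\mathrm{Lan}_H(\mathsf{d}^{\mathcal{A}}J)$ exists and is preserved by $\mathcal{A}(d^1)$ and by $\mathcal{A}(D^2)\cdot\mathcal{A}(d^1)$.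
   Context: Conventions: a $2$-category is a $\mathrm{Cat}$-enriched category; "morphism" means $1$-cell; $\cdot$ denotes composition of $1$-cells and vertical composition of $2$-cells; $*$ denotes horizontal composition (whiskering). The category $\Delta_3$: the subcategory of the category of finite nonempty ordinals and order-preserving maps with objects $\mathsf{1},\mathsf{2},\mathsf{3}$ generated by the maps $d^0,d^1:\mathsf{1}\to\mathsf{2}$, $s^0:\mathsf{2}\to\mathsf{1}$, $D^0,D^1,D^2:\mathsf{2}\to\mathsf{3}$ (the usual cofaces, $d^i$ and $D^i$ omitting $i$ from the image, and codegeneracy), subject to $s^0d^1=\mathrm{id}_{\mathsf{1}}=s^0d^0$ and $D^td^k=D^kd^{t-1}$ for $t>k$. A pseudofunctor $(\mathcal{A},\mathfrak{a}):\Delta_3\to\mathfrak{A}$ has invertible $2$-cells $\mathfrak{a}_{hg}:\mathcal{A}(h)\mathcal{A}(g)\Rightarrow\mathcal{A}(hg)$ and $\mathfrak{a}_x:\mathrm{id}_{\mathcal{A}(x)}\Rightarrow\mathcal{A}(\mathrm{id}_x)$ satisfying the usual associativity and identity coherence equations. Put $\mathcal{A}(\sigma_{01})=\mathfrak{a}_{D^0d^0}^{-1}\cdot\mathfrak{a}_{D^1d^0}$, $\mathcal{A}(\sigma_{02})=\mathfrak{a}_{D^0d^1}^{-1}\cdot\mathfrak{a}_{D^2d^0}$, $\mathcal{A}(\sigma_{12})=\mathfrak{a}_{D^1d^1}^{-1}\cdot\mathfrak{a}_{D^2d^1}$, $\mathcal{A}(\mathfrak{n}_0)=\mathfrak{a}_{\mathsf{1}}^{-1}\cdot\mathfrak{a}_{s^0d^0}$,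 $\mathcal{A}(\mathfrak{n}_1)=\mathfrak{a}_{\mathsf{1}}^{-1}\cdot\mathfrak{a}_{s^0d^1}$. Descent data: for a morphism $F:\mathtt{S}\to\mathcal{A}(\mathsf{1})$, an $\mathcal{A}$-descent datum for $F$ is a $2$-cell $\beta:\mathcal{A}(d^1)F\Rightarrow\mathcal{A}(d^0)F$ such that $(\mathcal{A}(\sigma_{01})*F)\cdot(\mathcal{A}(D^1)*\beta)\cdot(\mathcal{A}(\sigma_{12})*F)=(\mathcal{A}(D^0)*\beta)\cdot(\mathcal{A}(\sigma_{02})*F)\cdot(\mathcal{A}(D^2)*\beta)$ and $(\mathcal{A}(\mathfrak{n}_0)*F)\cdot(\mathcal{A}(s^0)*\beta)\cdot(\mathcal{A}(\mathfrak{n}_1)^{-1}*F)=\mathrm{id}_F$. Lax descent object: an object $\mathrm{lax}\text{-}\mathrm{Desc}(\mathcal{A})$ with a morphism $\mathsf{d}^{\mathcal{A}}:\mathrm{lax}\text{-}\mathrm{Desc}(\mathcal{A})\to\mathcal{A}(\mathsf{1})$ (the forgetful morphism) and an $\mathcal{A}$-descent datum $\psi:\mathcal{A}(d^1)\mathsf{d}^{\mathcal{A}}\Rightarrow\mathcal{A}(d^0)\mathsf{d}^{\mathcal{A}}$ for $\mathsf{d}^{\mathcal{A}}$ such that: (1) for each $F:\mathtt{S}\to\mathcal{A}(\mathsf{1})$ and each $\mathcal{A}$-descent datum $\beta$ for $F$ there is a unique $\check F:\mathtt{S}\to\mathrm{lax}\text{-}\mathrm{Desc}(\mathcal{A})$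 with $\mathsf{d}^{\mathcal{A}}\check F=F$ and $\psi*\check F=\beta$; (2) for all $F_1',F_0':\mathtt{S}\to\mathrm{lax}\text{-}\mathrm{Desc}(\mathcal{A})$ and each $2$-cell $\xi:\mathsf{d}^{\mathcal{A}}F_1'\Rightarrow\mathsf{d}^{\mathcal{A}}F_0'$ with $(\psi*F_0')\cdot(\mathcal{A}(d^1)*\xi)=(\mathcal{A}(d^0)*\xi)\cdot(\psi*F_1')$, there is a unique $2$-cell $\xi':F_1'\Rightarrow F_0'$ with $\mathsf{d}^{\mathcal{A}}*\xi'=\xi$. Kan extensions: for $J:\mathtt{S}\to\mathtt{C}$ and $H:\mathtt{S}\to\mathtt{B}$ in $\mathfrak{A}$, the right Kan extension of $J$ along $H$ is, if it exists, a pair $(\mathrm{Ran}_HJ:\mathtt{B}\to\mathtt{C},\ \gamma:(\mathrm{Ran}_HJ)H\Rightarrow J)$ such that for every $R:\mathtt{B}\to\mathtt{C}$ the map $\beta\mapsto\gamma\cdot(\beta*H)$ is a bijection from $2$-cells $R\Rightarrow\mathrm{Ran}_HJ$ to $2$-cells $RH\Rightarrow J$. A morphism $G:\mathtt{C}\to\mathtt{D}$ preserves $(\hat J,\gamma)=\mathrm{Ran}_HJ$ if $(G\hat J,G*\gamma)$ is the right Kan extension of $GJ$ along $H$. $G$ reflects the right Kan extension of $J$ along $H$ if, whenever $(G\hat J,G*\gamma)$ is the right Kan extension of $GJ$ along $H$, $(\hat J,\gamma)$ is the right Kan extension of $J$ along $H$. Assuming $\mathrm{Ran}_HGJ$ exists,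 $G$ creates the right Kan extension of $GJ$ along $H$ if $G$ reflects it and $\mathrm{Ran}_HJ$ exists and is preserved by $G$. Left Kan extensions $\mathrm{Lan}_HJ$, and their preservation, reflection and creation, are defined codually (reversing $2$-cells). *)

theory Defs
  imports Main
begin

section \<open>Categories and 2-categories\<close>

record ('o, 'a) cat =
  Obj :: "'o set"
  Arr :: "'a set"
  src :: "'a \<Rightarrow> 'o"
  trg :: "'a \<Rightarrow> 'o"
  one :: "'o \<Rightarrow> 'a"
  comp1 :: "'a \<Rightarrow> 'a \<Rightarrow> 'a"  (infixl \<open>\<cdot>\<index>\<close> 75)

locale category =
  fixes C :: "('o, 'a, 'z) cat_scheme" (structure)
  assumes src_Obj: "f \<in> Arr C \<Longrightarrow> src C f \<in> Obj C"
    and trg_Obj: "f \<in> Arr C \<Longrightarrow> trg C f \<in> Obj C"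
    and one_Arr: "x \<in> Obj C \<Longrightarrow> one C x \<in> Arr C"
    and src_one: "x \<in> Obj C \<Longrightarrow> src C (one C x) = x"
    and trg_one: "x \<in> Obj C \<Longrightarrow> trg C (one C x) = x"
    and comp_Arr: "\<lbrakk>f \<in> Arr C; g \<in> Arr C; trg C f = src C g\<rbrakk> \<Longrightarrow> g \<cdot> f \<in> Arr C"
    and src_comp: "\<lbrakk>f \<in> Arr C; g \<in> Arr C; trg C f = src C g\<rbrakk> \<Longrightarrow> src C (g \<cdot> f) = src C f"
    and trg_comp: "\<lbrakk>f \<in> Arr C; g \<in> Arr C; trg C f = src C g\<rbrakk> \<Longrightarrow> trg C (g \<cdot> f) = trg C g"
    and comp_one: "f \<in> Arr C \<Longrightarrow> f \<cdot> one C (src C f) = f"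
    and one_comp: "f \<in> Arr C \<Longrightarrow> one C (trg C f) \<cdot> f = f"
    and comp_assoc: "\<lbrakk>f \<in> Arr C; g \<in> Arr C; h \<in> Arr C; trg C f = src C g; trg C g = src C h\<rbrakk>
      \<Longrightarrow> h \<cdot> (g \<cdot> f) = (h \<cdot> g) \<cdot> f"

text \<open>
  In a 2-category, \<open>g \<cdot> f\<close> composes 1-cells, \<open>\<beta> \<bullet> \<alpha>\<close> is vertical composition
  (first \<open>\<alpha>\<close>, then \<open>\<beta>\<close>) and \<open>\<beta> \<star> \<alpha>\<close> is horizontal composition, with \<open>\<alpha>\<close>
  on the source side. A 2-cell \<open>\<alpha>\<close> goes from the 1-cell \<open>dom2 K \<alpha>\<close> to the 1-cell \<open>cod2 K \<alpha>\<close>.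
\<close>

record ('o, 'a, 'c) two_cat = "('o, 'a) cat" +
  Cell :: "'c set"
  dom2 :: "'c \<Rightarrow> 'a"
  cod2 :: "'c \<Rightarrow> 'a"
  one2 :: "'a \<Rightarrow> 'c"
  vcomp :: "'c \<Rightarrow> 'c \<Rightarrow> 'c"  (infixl \<open>\<bullet>\<index>\<close> 65)
  hcomp :: "'c \<Rightarrow> 'c \<Rightarrow> 'c"  (infixl \<open>\<star>\<index>\<close> 70)

locale two_category = category K for K :: "('o, 'a, 'c, 'z) two_cat_scheme" (structure) +
  assumes dom2_Arr: "\<alpha> \<in> Cell K \<Longrightarrow> dom2 K \<alpha> \<in> Arr K"
    and cod2_Arr: "\<alpha> \<in> Cell K \<Longrightarrow> cod2 K \<alpha> \<in> Arr K"
    and src_cod2: "\<alpha> \<in> Cell K \<Longrightarrow> src K (cod2 K \<alpha>) = src K (dom2 K \<alpha>)"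
    and trg_cod2: "\<alpha> \<in> Cell K \<Longrightarrow> trg K (cod2 K \<alpha>) = trg K (dom2 K \<alpha>)"
    and one2_Cell: "f \<in> Arr K \<Longrightarrow> one2 K f \<in> Cell K"
    and dom2_one2: "f \<in> Arr K \<Longrightarrow> dom2 K (one2 K f) = f"
    and cod2_one2: "f \<in> Arr K \<Longrightarrow> cod2 K (one2 K f) = f"
    and vcomp_Cell: "\<lbrakk>\<alpha> \<in> Cell K; \<beta> \<in> Cell K; cod2 K \<alpha> = dom2 K \<beta>\<rbrakk> \<Longrightarrow> \<beta> \<bullet> \<alpha> \<in> Cell K"
    and dom2_vcomp: "\<lbrakk>\<alpha> \<in> Cell K; \<beta> \<in> Cell K; cod2 K \<alpha> = dom2 K \<beta>\<rbrakk>
      \<Longrightarrow> dom2 K (\<beta> \<bullet> \<alpha>) = dom2 K \<alpha>"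
    and cod2_vcomp: "\<lbrakk>\<alpha> \<in> Cell K; \<beta> \<in> Cell K; cod2 K \<alpha> = dom2 K \<beta>\<rbrakk>
      \<Longrightarrow> cod2 K (\<beta> \<bullet> \<alpha>) = cod2 K \<beta>"
    and vcomp_one2: "\<alpha> \<in> Cell K \<Longrightarrow> \<alpha> \<bullet> one2 K (dom2 K \<alpha>) = \<alpha>"
    and one2_vcomp: "\<alpha> \<in> Cell K \<Longrightarrow> one2 K (cod2 K \<alpha>) \<bullet> \<alpha> = \<alpha>"
    and vcomp_assoc: "\<lbrakk>\<alpha> \<in> Cell K; \<beta> \<in> Cell K; \<gamma> \<in> Cell K; cod2 K \<alpha> = dom2 K \<beta>; cod2 K \<beta> = dom2 K \<gamma>\<rbrakk>
      \<Longrightarrow> \<gamma> \<bullet> (\<beta> \<bullet> \<alpha>) = (\<gamma> \<bullet> \<beta>) \<bullet> \<alpha>"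
    and hcomp_Cell: "\<lbrakk>\<alpha> \<in> Cell K; \<beta> \<in> Cell K; trg K (dom2 K \<alpha>) = src K (dom2 K \<beta>)\<rbrakk>
      \<Longrightarrow> \<beta> \<star> \<alpha> \<in> Cell K"
    and dom2_hcomp: "\<lbrakk>\<alpha> \<in> Cell K; \<beta> \<in> Cell K; trg K (dom2 K \<alpha>) = src K (dom2 K \<beta>)\<rbrakk>
      \<Longrightarrow> dom2 K (\<beta> \<star> \<alpha>) = dom2 K \<beta> \<cdot> dom2 K \<alpha>"
    and cod2_hcomp: "\<lbrakk>\<alpha> \<in> Cell K; \<beta> \<in> Cell K; trg K (dom2 K \<alpha>) = src K (dom2 K \<beta>)\<rbrakk>
      \<Longrightarrow> cod2 K (\<beta> \<star> \<alpha>) = cod2 K \<beta> \<cdot> cod2 K \<alpha>"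
    and hcomp_one2_one2: "\<lbrakk>f \<in> Arr K; g \<in> Arr K; trg K f = src K g\<rbrakk>
      \<Longrightarrow> one2 K g \<star> one2 K f = one2 K (g \<cdot> f)"
    and interchange: "\<lbrakk>\<alpha> \<in> Cell K; \<alpha>' \<in> Cell K; \<beta> \<in> Cell K; \<beta>' \<in> Cell K; cod2 K \<alpha> = dom2 K \<alpha>';
        cod2 K \<beta> = dom2 K \<beta>'; trg K (dom2 K \<alpha>) = src K (dom2 K \<beta>)\<rbrakk>
      \<Longrightarrow> (\<beta>' \<bullet> \<beta>) \<star> (\<alpha>' \<bullet> \<alpha>) = (\<beta>' \<star> \<alpha>') \<bullet> (\<beta> \<star> \<alpha>)"
    and hcomp_one: "\<alpha> \<in> Cell K \<Longrightarrow> \<alpha> \<star> one2 K (one K (src K (dom2 K \<alpha>))) = \<alpha>"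
    and one_hcomp: "\<alpha> \<in> Cell K \<Longrightarrow> one2 K (one K (trg K (dom2 K \<alpha>))) \<star> \<alpha> = \<alpha>"
    and hcomp_assoc: "\<lbrakk>\<alpha> \<in> Cell K; \<beta> \<in> Cell K; \<gamma> \<in> Cell K; trg K (dom2 K \<alpha>) = src K (dom2 K \<beta>);
        trg K (dom2 K \<beta>) = src K (dom2 K \<gamma>)\<rbrakk>
      \<Longrightarrow> \<gamma> \<star> (\<beta> \<star> \<alpha>) = (\<gamma> \<star> \<beta>) \<star> \<alpha>"

definition hom :: "('o, 'a, 'z) cat_scheme \<Rightarrow> 'o \<Rightarrow> 'o \<Rightarrow> 'a set" where
  "hom C x y = {f \<in> Arr C. src C f = x \<and> trg C f = y}"

definition cells :: "('o, 'a, 'c, 'z) two_cat_scheme \<Rightarrow> 'a \<Rightarrow> 'a \<Rightarrow> 'c set" where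
  "cells K f g = {\<alpha> \<in> Cell K. dom2 K \<alpha> = f \<and> cod2 K \<alpha> = g}"

definition whisker_left :: "('o, 'a, 'c, 'z) two_cat_scheme \<Rightarrow> 'a \<Rightarrow> 'c \<Rightarrow> 'c"
  (infixr \<open>\<rhd>\<index>\<close> 70) where
  "f \<rhd>\<^bsub>K\<^esub> \<alpha> = one2 K f \<star>\<^bsub>K\<^esub> \<alpha>"

definition whisker_right :: "('o, 'a, 'c, 'z) two_cat_scheme \<Rightarrow> 'c \<Rightarrow> 'a \<Rightarrow> 'c"
  (infixl \<open>\<lhd>\<index>\<close> 70) where
  "\<alpha> \<lhd>\<^bsub>K\<^esub> f = \<alpha> \<star>\<^bsub>K\<^esub> one2 K f"

definition inverse_cells :: "('o, 'a, 'c, 'z) two_cat_scheme \<Rightarrow> 'c \<Rightarrow> 'c \<Rightarrow> bool" where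
  "inverse_cells K \<alpha> \<beta> \<longleftrightarrow>
     \<alpha> \<in> Cell K \<and> \<beta> \<in> cells K (cod2 K \<alpha>) (dom2 K \<alpha>) \<and>
     \<beta> \<bullet>\<^bsub>K\<^esub> \<alpha> = one2 K (dom2 K \<alpha>) \<and> \<alpha> \<bullet>\<^bsub>K\<^esub> \<beta> = one2 K (cod2 K \<alpha>)"

definition invertible :: "('o, 'a, 'c, 'z) two_cat_scheme \<Rightarrow> 'c \<Rightarrow> bool" where
  "invertible K \<alpha> \<longleftrightarrow> (\<exists>\<beta>. inverse_cells K \<alpha> \<beta>)"

definition inv2 :: "('o, 'a, 'c, 'z) two_cat_scheme \<Rightarrow> 'c \<Rightarrow> 'c" where
  "inv2 K \<alpha> = (THE \<beta>. inverse_cells K \<alpha> \<beta>)"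


section \<open>Pseudofunctors from a category\<close>

text \<open>
  The source category is regarded as a locally discrete 2-category, so a pseudofunctor has no
  action on non-identity 2-cells and its comparison 2-cells are trivially natural.
  \<open>fcomp P h g\<close> is the 2-cell \<open>\<a>\<^bsub>hg\<^esub> : P(h) P(g) \<Rightarrow> P(hg)\<close> and \<open>fone P x\<close> is the 2-cell
  \<open>\<a>\<^bsub>x\<^esub> : id \<Rightarrow> P(id\<^bsub>x\<^esub>)\<close>.
\<close>

record ('x, 'y, 'o, 'a, 'c) psfun =
  fobj :: "'x \<Rightarrow> 'o"
  farr :: "'y \<Rightarrow> 'a"
  fcomp :: "'y \<Rightarrow> 'y \<Rightarrow> 'c"
  fone :: "'x \<Rightarrow> 'c"

locale pseudofunctor = C: category C + K: two_category K
  for C :: "('x, 'y, 'w) cat_scheme"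
    and K :: "('o, 'a, 'c, 'z) two_cat_scheme" (structure)
    and P :: "('x, 'y, 'o, 'a, 'c) psfun" +
  assumes fobj_Obj: "x \<in> Obj C \<Longrightarrow> fobj P x \<in> Obj K"
    and farr_hom: "f \<in> Arr C \<Longrightarrow> farr P f \<in> hom K (fobj P (src C f)) (fobj P (trg C f))"
    and fcomp_cells: "\<lbrakk>g \<in> Arr C; h \<in> Arr C; trg C g = src C h\<rbrakk>
      \<Longrightarrow> fcomp P h g \<in> cells K (farr P h \<cdot> farr P g) (farr P (h \<cdot>\<^bsub>C\<^esub> g))"
    and fcomp_invertible: "\<lbrakk>g \<in> Arr C; h \<in> Arr C; trg C g = src C h\<rbrakk>
      \<Longrightarrow> invertible K (fcomp P h g)"
    and fone_cells: "x \<in> Obj C \<Longrightarrow> fone P x \<in> cells K (one K (fobj P x)) (farr P (one C x))"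
    and fone_invertible: "x \<in> Obj C \<Longrightarrow> invertible K (fone P x)"
    and coherence_assoc: "\<lbrakk>f \<in> Arr C; g \<in> Arr C; h \<in> Arr C; trg C f = src C g; trg C g = src C h\<rbrakk>
      \<Longrightarrow> fcomp P h (g \<cdot>\<^bsub>C\<^esub> f) \<bullet> (farr P h \<rhd> fcomp P g f)
        = fcomp P (h \<cdot>\<^bsub>C\<^esub> g) f \<bullet> (fcomp P h g \<lhd> farr P f)"
    and coherence_src: "f \<in> Arr C
      \<Longrightarrow> fcomp P f (one C (src C f)) \<bullet> (farr P f \<rhd> fone P (src C f)) = one2 K (farr P f)"
    and coherence_trg: "f \<in> Arr C
      \<Longrightarrow> fcomp P (one C (trg C f)) f \<bullet> (fone P (trg C f) \<lhd> farr P f) = one2 K (farr P f)"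


section \<open>The category \<open>\<Delta>\<^sub>3\<close>\<close>

text \<open>
  The ordinal \<open>n\<close> is \<open>{0, \<dots>, n - 1}\<close>; an order-preserving map \<open>f : m \<rightarrow> n\<close> is encoded as the
  pair \<open>([f 0, \<dots>, f (m - 1)], n)\<close>.
\<close>

type_synonym ordmap = "nat list \<times> nat"

definition FinOrd :: "(nat, ordmap) cat" where
  "FinOrd = \<lparr>Obj = {n. n \<noteq> 0},
     Arr = {(xs, n). xs \<noteq> [] \<and> sorted xs \<and> (\<forall>i \<in> set xs. i < n)},
     src = (\<lambda>(xs, n). length xs), trg = snd,
     one = (\<lambda>n. ([0..<n], n)),
     comp1 = (\<lambda>(ys, p) (xs, n). (map (\<lambda>i. ys ! i) xs, p))\<rparr>"

definition d0 :: ordmap where "d0 = ([1], 2)"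
definition d1 :: ordmap where "d1 = ([0], 2)"
definition s0 :: ordmap where "s0 = ([0, 0], 1)"
definition D0 :: ordmap where "D0 = ([1, 2], 3)"
definition D1 :: ordmap where "D1 = ([0, 2], 3)"
definition D2 :: ordmap where "D2 = ([0, 1], 3)"

inductive_set Delta3_arr :: "ordmap set" where
  gen: "f \<in> {d0, d1, s0, D0, D1, D2} \<Longrightarrow> f \<in> Delta3_arr"
| one: "n \<in> {1, 2, 3} \<Longrightarrow> one FinOrd n \<in> Delta3_arr"
| comp: "\<lbrakk>f \<in> Delta3_arr; g \<in> Delta3_arr; trg FinOrd f = src FinOrd g\<rbrakk>
    \<Longrightarrow> g \<cdot>\<^bsub>FinOrd\<^esub> f \<in> Delta3_arr"

definition Delta3 :: "(nat, ordmap) cat" where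
  "Delta3 = FinOrd\<lparr>Obj := {1, 2, 3}, Arr := Delta3_arr\<rparr>"

lemma category_FinOrd: "category FinOrd"
proof unfold_locales
  fix f g h
  assume *: "f \<in> Arr FinOrd" "g \<in> Arr FinOrd" "trg FinOrd f = src FinOrd g"
  obtain xs n ys p where [simp]: "f = (xs, n)" "g = (ys, p)" by (cases f, cases g)
  have "sorted (map (\<lambda>i. ys ! i) xs)"
    using * by (auto simp: FinOrd_def sorted_map intro!: sorted_wrt_mono_rel[of xs "(\<le>)"] sorted_nth_mono)
  then show "g \<cdot>\<^bsub>FinOrd\<^esub> f \<in> Arr FinOrd" using * by (auto simp: FinOrd_def)
  show "h \<cdot>\<^bsub>FinOrd\<^esub> (g \<cdot>\<^bsub>FinOrd\<^esub> f) = h \<cdot>\<^bsub>FinOrd\<^esub> g \<cdot>\<^bsub>FinOrd\<^esub> f"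
    using * by (cases h) (auto simp: FinOrd_def)
qed (auto simp: FinOrd_def map_nth intro: nth_equalityI)

lemma Delta3_arr_FinOrd:
  "f \<in> Delta3_arr \<Longrightarrow> f \<in> Arr FinOrd \<and> src FinOrd f \<in> {1, 2, 3} \<and> trg FinOrd f \<in> {1, 2, 3}"
proof (induction rule: Delta3_arr.induct)
  case (comp f g)
  interpret category FinOrd by (rule category_FinOrd)
  show ?case using comp by (simp add: comp_Arr src_comp trg_comp)
qed (auto simp: FinOrd_def d0_def d1_def s0_def D0_def D1_def D2_def)

lemma category_Delta3: "category Delta3"
proof -
  interpret category FinOrd by (rule category_FinOrd)
  have [simp]: "Obj Delta3 = {1, 2, 3}" "Arr Delta3 = Delta3_arr" "src Delta3 = src FinOrd"
    "trg Delta3 = trg FinOrd" "one Delta3 = one FinOrd" "comp1 Delta3 = comp1 FinOrd"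
    by (simp_all add: Delta3_def)
  have [simp]: "n \<in> Obj FinOrd" if "n \<in> {1, 2, 3}" for n
    using that by (auto simp: FinOrd_def)
  show ?thesis
    by unfold_locales
      (use Delta3_arr_FinOrd in \<open>simp_all add: src_one trg_one src_comp trg_comp comp_one one_comp
        comp_assoc Delta3_arr.one Delta3_arr.comp del: insert_iff\<close>)
qed

lemma Delta3_relations:
  "s0 \<cdot>\<^bsub>Delta3\<^esub> d1 = one Delta3 1" "s0 \<cdot>\<^bsub>Delta3\<^esub> d0 = one Delta3 1"
  "D1 \<cdot>\<^bsub>Delta3\<^esub> d0 = D0 \<cdot>\<^bsub>Delta3\<^esub> d0"
  "D2 \<cdot>\<^bsub>Delta3\<^esub> d0 = D0 \<cdot>\<^bsub>Delta3\<^esub> d1"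
  "D2 \<cdot>\<^bsub>Delta3\<^esub> d1 = D1 \<cdot>\<^bsub>Delta3\<^esub> d1"
  by (simp_all add: Delta3_def FinOrd_def d0_def d1_def s0_def D0_def D1_def D2_def)


section \<open>Descent data and lax descent objects\<close>

context
  fixes K :: "('o, 'a, 'c, 'z) two_cat_scheme" (structure)
    and P :: "(nat, ordmap, 'o, 'a, 'c) psfun"
begin

definition sigma01 :: 'c where "sigma01 = inv2 K (fcomp P D0 d0) \<bullet> fcomp P D1 d0"
definition sigma02 :: 'c where "sigma02 = inv2 K (fcomp P D0 d1) \<bullet> fcomp P D2 d0"
definition sigma12 :: 'c where "sigma12 = inv2 K (fcomp P D1 d1) \<bullet> fcomp P D2 d1"
definition nu0 :: 'c where "nu0 = inv2 K (fone P 1) \<bullet> fcomp P s0 d0"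
definition nu1 :: 'c where "nu1 = inv2 K (fone P 1) \<bullet> fcomp P s0 d1"

definition descent_datum :: "'a \<Rightarrow> 'c \<Rightarrow> bool" where
  "descent_datum F \<beta> \<longleftrightarrow>
     F \<in> Arr K \<and> trg K F = fobj P 1 \<and>
     \<beta> \<in> cells K (farr P d1 \<cdot> F) (farr P d0 \<cdot> F) \<and>
     (sigma01 \<lhd> F) \<bullet> (farr P D1 \<rhd> \<beta>) \<bullet> (sigma12 \<lhd> F)
       = (farr P D0 \<rhd> \<beta>) \<bullet> (sigma02 \<lhd> F) \<bullet> (farr P D2 \<rhd> \<beta>) \<and>
     (nu0 \<lhd> F) \<bullet> (farr P s0 \<rhd> \<beta>) \<bullet> (inv2 K nu1 \<lhd> F) = one2 K F"

text \<open>\<open>lax_descent_object L d \<psi>\<close>: the object \<open>L\<close>, with forgetful morphism \<open>d\<close> and descent datum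
  \<open>\<psi>\<close> for \<open>d\<close>, is a lax descent object of \<open>P\<close>.\<close>

definition lax_descent_object :: "'o \<Rightarrow> 'a \<Rightarrow> 'c \<Rightarrow> bool" where
  "lax_descent_object L d \<psi> \<longleftrightarrow>
     L \<in> Obj K \<and> d \<in> hom K L (fobj P 1) \<and> descent_datum d \<psi> \<and>
     (\<forall>S \<in> Obj K. \<forall>F \<in> hom K S (fobj P 1). \<forall>\<beta>. descent_datum F \<beta> \<longrightarrow>
        (\<exists>!F'. F' \<in> hom K S L \<and> d \<cdot> F' = F \<and> \<psi> \<lhd> F' = \<beta>)) \<and>
     (\<forall>S \<in> Obj K. \<forall>F\<^sub>1 \<in> hom K S L. \<forall>F\<^sub>0 \<in> hom K S L. \<forall>\<xi> \<in> cells K (d \<cdot> F\<^sub>1) (d \<cdot> F\<^sub>0).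
        (\<psi> \<lhd> F\<^sub>0) \<bullet> (farr P d1 \<rhd> \<xi>) = (farr P d0 \<rhd> \<xi>) \<bullet> (\<psi> \<lhd> F\<^sub>1) \<longrightarrow>
        (\<exists>!\<xi>'. \<xi>' \<in> cells K F\<^sub>1 F\<^sub>0 \<and> d \<rhd> \<xi>' = \<xi>))"

end


section \<open>Kan extensions\<close>

text \<open>
  Kan extensions of \<open>J : S \<rightarrow> C\<close> along \<open>H : S \<rightarrow> B\<close>. In each predicate, \<open>E : B \<rightarrow> C\<close> is the
  candidate extension, with 2-cell \<open>\<gamma> : E H \<Rightarrow> J\<close> (right) or \<open>\<eta> : J \<Rightarrow> E H\<close> (left).
\<close>

context
  fixes K :: "('o, 'a, 'c, 'z) two_cat_scheme" (structure)
begin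

definition is_ran :: "'a \<Rightarrow> 'a \<Rightarrow> 'a \<Rightarrow> 'c \<Rightarrow> bool" where
  "is_ran H J E \<gamma> \<longleftrightarrow>
     H \<in> Arr K \<and> J \<in> Arr K \<and> src K J = src K H \<and>
     E \<in> hom K (trg K H) (trg K J) \<and> \<gamma> \<in> cells K (E \<cdot> H) J \<and>
     (\<forall>R \<in> hom K (trg K H) (trg K J).
        bij_betw (\<lambda>\<beta>. \<gamma> \<bullet> (\<beta> \<lhd> H)) (cells K R E) (cells K (R \<cdot> H) J))"

definition preserves_ran :: "'a \<Rightarrow> 'a \<Rightarrow> 'a \<Rightarrow> 'a \<Rightarrow> 'c \<Rightarrow> bool" where
  "preserves_ran G H J E \<gamma> \<longleftrightarrow> is_ran H (G \<cdot> J) (G \<cdot> E) (G \<rhd> \<gamma>)"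

definition reflects_ran :: "'a \<Rightarrow> 'a \<Rightarrow> 'a \<Rightarrow> bool" where
  "reflects_ran G H J \<longleftrightarrow>
     (\<forall>E \<in> hom K (trg K H) (trg K J). \<forall>\<gamma> \<in> cells K (E \<cdot> H) J.
        is_ran H (G \<cdot> J) (G \<cdot> E) (G \<rhd> \<gamma>) \<longrightarrow> is_ran H J E \<gamma>)"

text \<open>\<open>creates_ran G H J\<close>: \<open>G\<close> creates the right Kan extension of \<open>G J\<close> along \<open>H\<close>. The
  presupposed existence of the latter follows from the second conjunct.\<close>

definition creates_ran :: "'a \<Rightarrow> 'a \<Rightarrow> 'a \<Rightarrow> bool" where
  "creates_ran G H J \<longleftrightarrow>
     reflects_ran G H J \<and> (\<exists>E \<gamma>. is_ran H J E \<gamma> \<and> preserves_ran G H J E \<gamma>)"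

definition is_lan :: "'a \<Rightarrow> 'a \<Rightarrow> 'a \<Rightarrow> 'c \<Rightarrow> bool" where
  "is_lan H J E \<eta> \<longleftrightarrow>
     H \<in> Arr K \<and> J \<in> Arr K \<and> src K J = src K H \<and>
     E \<in> hom K (trg K H) (trg K J) \<and> \<eta> \<in> cells K J (E \<cdot> H) \<and>
     (\<forall>R \<in> hom K (trg K H) (trg K J).
        bij_betw (\<lambda>\<beta>. (\<beta> \<lhd> H) \<bullet> \<eta>) (cells K E R) (cells K J (R \<cdot> H)))"

definition preserves_lan :: "'a \<Rightarrow> 'a \<Rightarrow> 'a \<Rightarrow> 'a \<Rightarrow> 'c \<Rightarrow> bool" where
  "preserves_lan G H J E \<eta> \<longleftrightarrow> is_lan H (G \<cdot> J) (G \<cdot> E) (G \<rhd> \<eta>)"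

definition reflects_lan :: "'a \<Rightarrow> 'a \<Rightarrow> 'a \<Rightarrow> bool" where
  "reflects_lan G H J \<longleftrightarrow>
     (\<forall>E \<in> hom K (trg K H) (trg K J). \<forall>\<eta> \<in> cells K J (E \<cdot> H).
        is_lan H (G \<cdot> J) (G \<cdot> E) (G \<rhd> \<eta>) \<longrightarrow> is_lan H J E \<eta>)"

definition creates_lan :: "'a \<Rightarrow> 'a \<Rightarrow> 'a \<Rightarrow> bool" where
  "creates_lan G H J \<longleftrightarrow>
     reflects_lan G H J \<and> (\<exists>E \<eta>. is_lan H J E \<eta> \<and> preserves_lan G H J E \<eta>)"

end

end

theory Submission
  imports Defs
begin

text \<open>
  Let \<open>\<gamma> : E H \<Rightarrow> d J\<close> be the right Kan extension of \<open>d J\<close> along \<open>H\<close>. Since \<open>\<A>(d\<^sup>0)\<close> preserves it,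
  the cell \<open>(\<psi> * J) \<cdot> (\<A>(d\<^sup>1) * \<gamma>) : \<A>(d\<^sup>1) E H \<Rightarrow> \<A>(d\<^sup>0) d J\<close> factors uniquely through
  \<open>\<A>(d\<^sup>0) * \<gamma>\<close>, by a cell \<open>\<phi> : \<A>(d\<^sup>1) E \<Rightarrow> \<A>(d\<^sup>0) E\<close>. This \<open>\<phi>\<close> is a descent datum for \<open>E\<close>. The
  two sides of its cocycle law end in \<open>\<A>(D\<^sup>0) \<A>(d\<^sup>0) E\<close>, which is again a Kan extension, so it is
  enough to compare them after whiskering with \<open>H\<close> and composing with
  \<open>\<A>(D\<^sup>0) \<A>(d\<^sup>0) * \<gamma>\<close>; there \<open>\<gamma>\<close> slides through all three factors and turns one law into the law
  for \<open>\<psi> * J\<close>. The unit law ends in \<open>E\<close> itself and is treated in the same way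
  (\<open>datum_transfer\<close>). Hence \<open>E = d E'\<close> with \<open>\<psi> * E' = \<phi>\<close>, and the defining property of \<open>\<phi>\<close> says that
  \<open>\<gamma>\<close> is compatible with the descent data, so that \<open>\<gamma> = d * \<gamma>'\<close> for some \<open>\<gamma>' : E' H \<Rightarrow> J\<close>.

  That \<open>(E', \<gamma>')\<close> is a Kan extension, and that \<open>d\<close> reflects Kan extensions, is one and the same
  argument (\<open>is_ran_lift\<close>): a factorization through \<open>d * \<gamma>'\<close> is compatible with the descent data
  because both sides of the compatibility agree after composing with \<open>\<A>(d\<^sup>0) d * \<gamma>'\<close>, along which
  cells can be cancelled. For an arbitrary Kan extension of \<open>d J\<close> this cancellation is inherited from
  the preserved one along the comparison isomorphism (\<open>preserved_ran_cancel\<close>).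

  Left Kan extensions are handled by duality. Descent data are expressed by the images of the
  generators of \<open>\<Delta>\<^sub>3\<close> and by the five cells \<open>\<sigma>\<^sub>0\<^sub>1, \<sigma>\<^sub>0\<^sub>2, \<sigma>\<^sub>1\<^sub>2, \<nu> = \<nn>\<^sub>0, \<mu> = \<nn>\<^sub>1\<^sup>-\<^sup>1\<close>, and such a
  diagram (\<open>descent_diagram\<close>) is self-dual: reversing 2-cells and exchanging \<open>d\<^sup>0\<close> with \<open>d\<^sup>1\<close>,
  \<open>D\<^sup>0\<close> with \<open>D\<^sup>2\<close>, \<open>\<sigma>\<^sub>0\<^sub>1\<close> with \<open>\<sigma>\<^sub>1\<^sub>2\<close> and \<open>\<nu>\<close> with \<open>\<mu>\<close> leaves both laws of a descent datum as they
  are, up to bracketing. So the statement on left Kan extensions is the one on right Kan extensions in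
  the dual 2-category.
\<close>

section \<open>Whiskering\<close>

context category
begin

lemma homD:
  assumes "f \<in> hom C x y"
  shows "f \<in> Arr C" "src C f = x" "trg C f = y" "x \<in> Obj C" "y \<in> Obj C"
  using assms src_Obj trg_Obj by (auto simp: hom_def)

lemma comp_hom: "\<lbrakk>g \<in> hom C y z; f \<in> hom C x y\<rbrakk> \<Longrightarrow> g \<cdot> f \<in> hom C x z"
  by (auto simp: hom_def comp_Arr src_comp trg_comp)

end

context two_category
begin

lemmas typing = src_Obj trg_Obj one_Arr src_one trg_one comp_Arr src_comp trg_comp
  dom2_Arr cod2_Arr src_cod2 trg_cod2 one2_Cell dom2_one2 cod2_one2
  vcomp_Cell dom2_vcomp cod2_vcomp hcomp_Cell dom2_hcomp cod2_hcomp

lemma cellsD: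
  assumes "\<alpha> \<in> cells K f g"
  shows "\<alpha> \<in> Cell K" "dom2 K \<alpha> = f" "cod2 K \<alpha> = g" "f \<in> Arr K" "g \<in> Arr K"
    "src K g = src K f" "trg K g = trg K f"
  using assms src_cod2 trg_cod2 dom2_Arr cod2_Arr by (auto simp: cells_def)

lemma cells_hom_cod: "\<lbrakk>\<alpha> \<in> cells K f g; f \<in> hom K x y\<rbrakk> \<Longrightarrow> g \<in> hom K x y"
  using cellsD[of \<alpha> f g] by (auto simp: hom_def)

lemma cells_hom_dom: "\<lbrakk>\<alpha> \<in> cells K f g; g \<in> hom K x y\<rbrakk> \<Longrightarrow> f \<in> hom K x y"
  using cellsD[of \<alpha> f g] by (auto simp: hom_def)

lemma vcomp_cells: "\<lbrakk>\<alpha> \<in> cells K f g; \<beta> \<in> cells K g h\<rbrakk> \<Longrightarrow> \<beta> \<bullet> \<alpha> \<in> cells K f h"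
  by (auto simp: cells_def typing)

lemma vcomp_assoc_cells:
  "\<lbrakk>\<alpha> \<in> cells K f g; \<beta> \<in> cells K g h; \<gamma> \<in> cells K h k\<rbrakk> \<Longrightarrow> \<gamma> \<bullet> (\<beta> \<bullet> \<alpha>) = \<gamma> \<bullet> \<beta> \<bullet> \<alpha>"
  by (auto simp: cells_def vcomp_assoc)

lemma whisker_left_cells:
  "\<lbrakk>k \<in> hom K y z; \<alpha> \<in> cells K f g; f \<in> hom K x y\<rbrakk> \<Longrightarrow> k \<rhd> \<alpha> \<in> cells K (k \<cdot> f) (k \<cdot> g)"
  by (auto simp: cells_def hom_def whisker_left_def typing)

lemma whisker_right_cells:
  "\<lbrakk>\<alpha> \<in> cells K f g; f \<in> hom K y z; k \<in> hom K x y\<rbrakk> \<Longrightarrow> \<alpha> \<lhd> k \<in> cells K (f \<cdot> k) (g \<cdot> k)"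
  by (auto simp: cells_def hom_def whisker_right_def typing)

lemma whisker_left_vcomp:
  assumes "k \<in> hom K y z" "\<alpha> \<in> cells K f g" "\<beta> \<in> cells K g h" "f \<in> hom K x y"
  shows "k \<rhd> (\<beta> \<bullet> \<alpha>) = (k \<rhd> \<beta>) \<bullet> (k \<rhd> \<alpha>)"
proof -
  have "one2 K k = one2 K k \<bullet> one2 K k"
    using assms one2_vcomp[of "one2 K k"] by (simp add: hom_def typing)
  then show ?thesis
    using assms interchange[of \<alpha> \<beta> "one2 K k" "one2 K k"]
    by (auto simp: hom_def cells_def whisker_left_def typing)
qed

lemma whisker_right_vcomp:
  assumes "\<alpha> \<in> cells K f g" "\<beta> \<in> cells K g h" "f \<in> hom K y z" "k \<in> hom K x y"
  shows "(\<beta> \<bullet> \<alpha>) \<lhd> k = (\<beta> \<lhd> k) \<bullet> (\<alpha> \<lhd> k)"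
proof -
  have "one2 K k = one2 K k \<bullet> one2 K k"
    using assms one2_vcomp[of "one2 K k"] by (simp add: hom_def typing)
  then show ?thesis
    using assms interchange[of "one2 K k" "one2 K k" \<alpha> \<beta>]
    by (auto simp: hom_def cells_def whisker_right_def typing)
qed

lemma whisker_left_comp:
  "\<lbrakk>h \<in> hom K y z; k \<in> hom K x y; \<alpha> \<in> cells K f g; f \<in> hom K w x\<rbrakk> \<Longrightarrow> (h \<cdot> k) \<rhd> \<alpha> = h \<rhd> (k \<rhd> \<alpha>)"
  by (auto simp: cells_def hom_def whisker_left_def typing hcomp_assoc hcomp_one2_one2)

lemma whisker_right_comp:
  "\<lbrakk>\<alpha> \<in> cells K f g; f \<in> hom K y z; h \<in> hom K x y; k \<in> hom K w x\<rbrakk> \<Longrightarrow> \<alpha> \<lhd> (h \<cdot> k) = \<alpha> \<lhd> h \<lhd> k"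
  by (auto simp: cells_def hom_def whisker_right_def typing hcomp_assoc[symmetric] hcomp_one2_one2)

lemma whisker_left_right:
  "\<lbrakk>h \<in> hom K y z; \<alpha> \<in> cells K f g; f \<in> hom K x y; k \<in> hom K w x\<rbrakk> \<Longrightarrow> (h \<rhd> \<alpha>) \<lhd> k = h \<rhd> (\<alpha> \<lhd> k)"
  by (auto simp: cells_def hom_def whisker_left_def whisker_right_def typing hcomp_assoc)

text \<open>
  Naturality of whiskering: both sides are the horizontal composite of \<open>\<alpha>\<close> and \<open>\<beta>\<close>, by interchange.
\<close>

lemma whisker_exchange:
  assumes "\<alpha> \<in> cells K f g" "f \<in> hom K y z" "\<beta> \<in> cells K h k" "h \<in> hom K x y"
  shows "(\<alpha> \<lhd> k) \<bullet> (f \<rhd> \<beta>) = (g \<rhd> \<beta>) \<bullet> (\<alpha> \<lhd> h)"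
proof -
  have "(\<alpha> \<lhd> k) \<bullet> (f \<rhd> \<beta>) = (\<alpha> \<bullet> one2 K f) \<star> (one2 K k \<bullet> \<beta>)"
    using assms interchange[of \<beta> "one2 K k" "one2 K f" \<alpha>]
    by (auto simp: hom_def cells_def whisker_left_def whisker_right_def typing)
  also have "\<dots> = (one2 K g \<bullet> \<alpha>) \<star> (\<beta> \<bullet> one2 K h)"
    using assms by (auto simp: cells_def vcomp_one2 one2_vcomp)
  also have "\<dots> = (g \<rhd> \<beta>) \<bullet> (\<alpha> \<lhd> h)"
    using assms interchange[of "one2 K h" \<beta> \<alpha> "one2 K g"]
    by (auto simp: hom_def cells_def whisker_left_def whisker_right_def typing)
  finally show ?thesis .
qed

lemma whisker_right_one2:
  "\<lbrakk>f \<in> hom K y z; k \<in> hom K x y\<rbrakk> \<Longrightarrow> one2 K f \<lhd> k = one2 K (f \<cdot> k)"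
  by (auto simp: hom_def whisker_right_def hcomp_one2_one2)

lemma one_whisker: "\<lbrakk>\<alpha> \<in> cells K f g; f \<in> hom K x y\<rbrakk> \<Longrightarrow> one K y \<rhd> \<alpha> = \<alpha>"
  by (auto simp: cells_def hom_def whisker_left_def one_hcomp)

lemma one2_cells: "f \<in> hom K x y \<Longrightarrow> one2 K f \<in> cells K f f"
  by (auto simp: cells_def hom_def typing)

lemma vcomp_one2_cells: "\<alpha> \<in> cells K f g \<Longrightarrow> \<alpha> \<bullet> one2 K f = \<alpha>"
  by (auto simp: cells_def vcomp_one2)

lemma one2_vcomp_cells: "\<alpha> \<in> cells K f g \<Longrightarrow> one2 K g \<bullet> \<alpha> = \<alpha>"
  by (auto simp: cells_def one2_vcomp)

text \<open>
  Three commuting squares placed side by side: the cell \<open>g\<^sub>3\<close> at one end passes through a string of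
  three cells and comes out as \<open>g\<^sub>0\<close> at the other end.
\<close>

lemma vcomp_slide:
  assumes e: "e\<^sub>1 \<in> cells K p\<^sub>0 p\<^sub>1" "e\<^sub>2 \<in> cells K p\<^sub>1 p\<^sub>2" "e\<^sub>3 \<in> cells K p\<^sub>2 p\<^sub>3"
    and f: "f\<^sub>1 \<in> cells K q\<^sub>0 q\<^sub>1" "f\<^sub>2 \<in> cells K q\<^sub>1 q\<^sub>2" "f\<^sub>3 \<in> cells K q\<^sub>2 q\<^sub>3"
    and g: "g\<^sub>0 \<in> cells K p\<^sub>0 q\<^sub>0" "g\<^sub>1 \<in> cells K p\<^sub>1 q\<^sub>1" "g\<^sub>2 \<in> cells K p\<^sub>2 q\<^sub>2" "g\<^sub>3 \<in> cells K p\<^sub>3 q\<^sub>3"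
    and squares: "g\<^sub>1 \<bullet> e\<^sub>1 = f\<^sub>1 \<bullet> g\<^sub>0" "g\<^sub>2 \<bullet> e\<^sub>2 = f\<^sub>2 \<bullet> g\<^sub>1" "g\<^sub>3 \<bullet> e\<^sub>3 = f\<^sub>3 \<bullet> g\<^sub>2"
  shows "g\<^sub>3 \<bullet> (e\<^sub>3 \<bullet> e\<^sub>2 \<bullet> e\<^sub>1) = f\<^sub>3 \<bullet> f\<^sub>2 \<bullet> f\<^sub>1 \<bullet> g\<^sub>0"
proof -
  note as = vcomp_assoc_cells and vc = vcomp_cells
  have "g\<^sub>3 \<bullet> (e\<^sub>3 \<bullet> e\<^sub>2 \<bullet> e\<^sub>1) = g\<^sub>3 \<bullet> e\<^sub>3 \<bullet> e\<^sub>2 \<bullet> e\<^sub>1"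
    using as[OF e(1) vc[OF e(2,3)] g(4)] as[OF e(2,3) g(4)] by simp
  also have "\<dots> = f\<^sub>3 \<bullet> (f\<^sub>2 \<bullet> g\<^sub>1) \<bullet> e\<^sub>1"
    using as[OF e(2) g(3) f(3)] by (simp add: squares(2,3))
  also have "\<dots> = f\<^sub>3 \<bullet> f\<^sub>2 \<bullet> (f\<^sub>1 \<bullet> g\<^sub>0)"
    using as[OF g(2) f(2,3)] as[OF e(1) g(2) vc[OF f(2,3)]] by (simp add: squares(1))
  also have "\<dots> = f\<^sub>3 \<bullet> f\<^sub>2 \<bullet> f\<^sub>1 \<bullet> g\<^sub>0"
    using as[OF g(1) f(1) vc[OF f(2,3)]] .
  finally show ?thesis .
qed

lemma comp_assoc_hom:
  "\<lbrakk>h \<in> hom K y z; g \<in> hom K x y; f \<in> hom K w x\<rbrakk> \<Longrightarrow> h \<cdot> (g \<cdot> f) = h \<cdot> g \<cdot> f"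
  by (auto simp: hom_def comp_assoc)

end


section \<open>Right Kan extensions\<close>

context two_category
begin

lemma is_ranD:
  assumes "is_ran K H J E \<gamma>"
  shows "E \<in> hom K (trg K H) (trg K J)" "\<gamma> \<in> cells K (E \<cdot> H) J" "H \<in> Arr K" "J \<in> Arr K" "src K J = src K H"
  using assms by (auto simp: is_ran_def)

lemma is_ran_factor:
  assumes "is_ran K H J E \<gamma>" "R \<in> hom K (trg K H) (trg K J)" "\<delta> \<in> cells K (R \<cdot> H) J"
  obtains \<beta> where "\<beta> \<in> cells K R E" "\<gamma> \<bullet> (\<beta> \<lhd> H) = \<delta>"
proof -
  have "bij_betw (\<lambda>\<beta>. \<gamma> \<bullet> (\<beta> \<lhd> H)) (cells K R E) (cells K (R \<cdot> H) J)"
    using assms by (auto simp: is_ran_def)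
  then have "\<delta> \<in> (\<lambda>\<beta>. \<gamma> \<bullet> (\<beta> \<lhd> H)) ` cells K R E"
    using assms(3) by (simp add: bij_betw_def)
  then show ?thesis using that by auto
qed

lemma is_ran_cancel:
  assumes "is_ran K H J E \<gamma>" "\<beta>\<^sub>1 \<in> cells K R E" "\<beta>\<^sub>2 \<in> cells K R E"
    "\<gamma> \<bullet> (\<beta>\<^sub>1 \<lhd> H) = \<gamma> \<bullet> (\<beta>\<^sub>2 \<lhd> H)"
  shows "\<beta>\<^sub>1 = \<beta>\<^sub>2"
proof -
  have "R \<in> hom K (trg K H) (trg K J)"
    using cells_hom_dom[OF assms(2) is_ranD(1)[OF assms(1)]] .
  then have "bij_betw (\<lambda>\<beta>. \<gamma> \<bullet> (\<beta> \<lhd> H)) (cells K R E) (cells K (R \<cdot> H) J)"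
    using assms by (auto simp: is_ran_def)
  then show ?thesis using assms(2-4) by (auto simp: bij_betw_def inj_on_def)
qed

text \<open>
  Preservation is a property of one chosen Kan extension, but its uniqueness half holds for every
  other Kan extension \<open>(E', \<gamma>')\<close> as well: whiskering with \<open>G\<close> carries the comparison
  \<open>\<theta> : E' \<Rightarrow> E\<close> to a split monomorphism, and \<open>G * \<gamma>'\<close> is \<open>G * \<gamma>\<close> precomposed with \<open>G * \<theta> * H\<close>.
\<close>

lemma preserved_ran_cancel:
  assumes ran: "is_ran K H J E \<gamma>" and ran': "is_ran K H J E' \<gamma>'"
    and pres: "preserves_ran K G H J E \<gamma>"
    and H: "H \<in> hom K S B" and J: "J \<in> hom K S C" and G: "G \<in> hom K C D"
    and \<beta>: "\<beta>\<^sub>1 \<in> cells K R (G \<cdot> E')" "\<beta>\<^sub>2 \<in> cells K R (G \<cdot> E')"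
    and eq: "(G \<rhd> \<gamma>') \<bullet> (\<beta>\<^sub>1 \<lhd> H) = (G \<rhd> \<gamma>') \<bullet> (\<beta>\<^sub>2 \<lhd> H)"
  shows "\<beta>\<^sub>1 = \<beta>\<^sub>2"
proof -
  note [simp] = homD(2,3)[OF H] homD(2,3)[OF J]
  have E: "E \<in> hom K B C" and E': "E' \<in> hom K B C"
    and \<gamma>: "\<gamma> \<in> cells K (E \<cdot> H) J" and \<gamma>': "\<gamma>' \<in> cells K (E' \<cdot> H) J"
    using is_ranD(1,2)[OF ran] is_ranD(1,2)[OF ran'] by simp_all
  obtain \<theta> where \<theta>: "\<theta> \<in> cells K E' E" and \<theta>_eq: "\<gamma> \<bullet> (\<theta> \<lhd> H) = \<gamma>'"
    using is_ran_factor[OF ran _ \<gamma>'] E' by auto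
  obtain \<theta>' where \<theta>': "\<theta>' \<in> cells K E E'" and \<theta>'_eq: "\<gamma>' \<bullet> (\<theta>' \<lhd> H) = \<gamma>"
    using is_ran_factor[OF ran' _ \<gamma>] E by auto
  have \<theta>H: "\<theta> \<lhd> H \<in> cells K (E' \<cdot> H) (E \<cdot> H)" and \<theta>'H: "\<theta>' \<lhd> H \<in> cells K (E \<cdot> H) (E' \<cdot> H)"
    using whisker_right_cells \<theta> \<theta>' E E' H by blast+
  have EH: "E \<cdot> H \<in> hom K S C" and E'H: "E' \<cdot> H \<in> hom K S C"
    using comp_hom E E' H by blast+
  have inv: "\<theta>' \<bullet> \<theta> = one2 K E'"
  proof (rule is_ran_cancel[OF ran'])
    show "\<theta>' \<bullet> \<theta> \<in> cells K E' E'" using vcomp_cells \<theta> \<theta>' by blast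
    show "one2 K E' \<in> cells K E' E'" using one2_cells E' by blast
    have "\<gamma>' \<bullet> ((\<theta>' \<bullet> \<theta>) \<lhd> H) = \<gamma>' \<bullet> ((\<theta>' \<lhd> H) \<bullet> (\<theta> \<lhd> H))"
      using whisker_right_vcomp[OF \<theta> \<theta>' E' H] by simp
    also have "\<dots> = \<gamma>'"
      using vcomp_assoc_cells[OF \<theta>H \<theta>'H \<gamma>'] by (simp add: \<theta>_eq \<theta>'_eq)
    finally show "\<gamma>' \<bullet> ((\<theta>' \<bullet> \<theta>) \<lhd> H) = \<gamma>' \<bullet> (one2 K E' \<lhd> H)"
      using whisker_right_one2[OF E' H] vcomp_one2_cells[OF \<gamma>'] by simp
  qed
  have G\<theta>: "G \<rhd> \<theta> \<in> cells K (G \<cdot> E') (G \<cdot> E)" and G\<theta>': "G \<rhd> \<theta>' \<in> cells K (G \<cdot> E) (G \<cdot> E')"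
    using whisker_left_cells G \<theta> \<theta>' E E' by blast+
  have ranG: "is_ran K H (G \<cdot> J) (G \<cdot> E) (G \<rhd> \<gamma>)"
    using pres by (simp add: preserves_ran_def)
  have push: "(G \<rhd> \<gamma>) \<bullet> (((G \<rhd> \<theta>) \<bullet> \<beta>) \<lhd> H) = (G \<rhd> \<gamma>') \<bullet> (\<beta> \<lhd> H)"
    if \<beta>: "\<beta> \<in> cells K R (G \<cdot> E')" for \<beta>
  proof -
    have R: "R \<in> hom K B D" using cells_hom_dom[OF \<beta>] comp_hom[OF G E'] by simp
    have \<beta>H: "\<beta> \<lhd> H \<in> cells K (R \<cdot> H) (G \<cdot> (E' \<cdot> H))"
      using whisker_right_cells[OF \<beta> R H] comp_assoc_hom[OF G E' H] by simp
    have "((G \<rhd> \<theta>) \<bullet> \<beta>) \<lhd> H = (G \<rhd> (\<theta> \<lhd> H)) \<bullet> (\<beta> \<lhd> H)"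
      using whisker_right_vcomp[OF \<beta> G\<theta> R H] whisker_left_right[OF G \<theta> E' H] by simp
    then have "(G \<rhd> \<gamma>) \<bullet> (((G \<rhd> \<theta>) \<bullet> \<beta>) \<lhd> H) = (G \<rhd> \<gamma>) \<bullet> (G \<rhd> (\<theta> \<lhd> H)) \<bullet> (\<beta> \<lhd> H)"
      using vcomp_assoc_cells[OF \<beta>H whisker_left_cells[OF G \<theta>H E'H] whisker_left_cells[OF G \<gamma> EH]]
      by simp
    also have "\<dots> = (G \<rhd> \<gamma>') \<bullet> (\<beta> \<lhd> H)"
      using whisker_left_vcomp[OF G \<theta>H \<gamma> E'H] \<theta>_eq by simp
    finally show ?thesis .
  qed
  have "(G \<rhd> \<theta>) \<bullet> \<beta>\<^sub>1 = (G \<rhd> \<theta>) \<bullet> \<beta>\<^sub>2"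
    by (rule is_ran_cancel[OF ranG]) (use vcomp_cells \<beta> G\<theta> push eq in auto)
  moreover have "(G \<rhd> \<theta>') \<bullet> ((G \<rhd> \<theta>) \<bullet> \<beta>) = \<beta>" if \<beta>: "\<beta> \<in> cells K R (G \<cdot> E')" for \<beta>
  proof -
    have "(G \<rhd> \<theta>') \<bullet> (G \<rhd> \<theta>) = one2 K (G \<cdot> E')"
      using whisker_left_vcomp[OF G \<theta> \<theta>' E'] inv G E'
      by (auto simp: whisker_left_def hcomp_one2_one2 hom_def)
    then show ?thesis
      using vcomp_assoc_cells[OF \<beta> G\<theta> G\<theta>'] one2_vcomp_cells[OF \<beta>] by simp
  qed
  ultimately show ?thesis using \<beta> by metis
qed

end


section \<open>Descent data\<close>

text \<open>
  The part of a pseudofunctor on \<open>\<Delta>\<^sub>3\<close> that enters the definition of a descent datum. The cell \<open>\<mu>\<close> stands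
  for the inverse of \<open>\<nn>\<^sub>1\<close>; taking it as the primitive one lets the diagram carry over to the dual
  2-category.
\<close>

locale descent_diagram = two_category K for K :: "('o, 'a, 'c, 'z) two_cat_scheme" (structure) +
  fixes A\<^sub>1 A\<^sub>2 A\<^sub>3 :: 'o and \<delta>\<^sub>0 \<delta>\<^sub>1 \<epsilon> \<Delta>\<^sub>0 \<Delta>\<^sub>1 \<Delta>\<^sub>2 :: 'a and \<sigma>\<^sub>0\<^sub>1 \<sigma>\<^sub>0\<^sub>2 \<sigma>\<^sub>1\<^sub>2 \<nu> \<mu> :: 'c
  assumes delta0: "\<delta>\<^sub>0 \<in> hom K A\<^sub>1 A\<^sub>2" and delta1: "\<delta>\<^sub>1 \<in> hom K A\<^sub>1 A\<^sub>2"
    and eps: "\<epsilon> \<in> hom K A\<^sub>2 A\<^sub>1"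
    and Delta0: "\<Delta>\<^sub>0 \<in> hom K A\<^sub>2 A\<^sub>3" and Delta1: "\<Delta>\<^sub>1 \<in> hom K A\<^sub>2 A\<^sub>3" and Delta2: "\<Delta>\<^sub>2 \<in> hom K A\<^sub>2 A\<^sub>3"
    and sigma01: "\<sigma>\<^sub>0\<^sub>1 \<in> cells K (\<Delta>\<^sub>1 \<cdot> \<delta>\<^sub>0) (\<Delta>\<^sub>0 \<cdot> \<delta>\<^sub>0)"
    and sigma02: "\<sigma>\<^sub>0\<^sub>2 \<in> cells K (\<Delta>\<^sub>2 \<cdot> \<delta>\<^sub>0) (\<Delta>\<^sub>0 \<cdot> \<delta>\<^sub>1)"
    and sigma12: "\<sigma>\<^sub>1\<^sub>2 \<in> cells K (\<Delta>\<^sub>2 \<cdot> \<delta>\<^sub>1) (\<Delta>\<^sub>1 \<cdot> \<delta>\<^sub>1)"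
    and nu: "\<nu> \<in> cells K (\<epsilon> \<cdot> \<delta>\<^sub>0) (one K A\<^sub>1)"
    and mu: "\<mu> \<in> cells K (one K A\<^sub>1) (\<epsilon> \<cdot> \<delta>\<^sub>1)"
begin

definition datum :: "'a \<Rightarrow> 'c \<Rightarrow> bool" where
  "datum F \<beta> \<longleftrightarrow>
     F \<in> Arr K \<and> trg K F = A\<^sub>1 \<and> \<beta> \<in> cells K (\<delta>\<^sub>1 \<cdot> F) (\<delta>\<^sub>0 \<cdot> F) \<and>
     (\<sigma>\<^sub>0\<^sub>1 \<lhd> F) \<bullet> (\<Delta>\<^sub>1 \<rhd> \<beta>) \<bullet> (\<sigma>\<^sub>1\<^sub>2 \<lhd> F) = (\<Delta>\<^sub>0 \<rhd> \<beta>) \<bullet> (\<sigma>\<^sub>0\<^sub>2 \<lhd> F) \<bullet> (\<Delta>\<^sub>2 \<rhd> \<beta>) \<and>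
     (\<nu> \<lhd> F) \<bullet> (\<epsilon> \<rhd> \<beta>) \<bullet> (\<mu> \<lhd> F) = one2 K F"

context
  fixes F \<beta> S
  assumes F: "F \<in> hom K S A\<^sub>1" and beta: "\<beta> \<in> cells K (\<delta>\<^sub>1 \<cdot> F) (\<delta>\<^sub>0 \<cdot> F)"
begin

lemma datum_cells:
  "\<sigma>\<^sub>0\<^sub>1 \<lhd> F \<in> cells K (\<Delta>\<^sub>1 \<cdot> (\<delta>\<^sub>0 \<cdot> F)) (\<Delta>\<^sub>0 \<cdot> (\<delta>\<^sub>0 \<cdot> F))"
  "\<sigma>\<^sub>0\<^sub>2 \<lhd> F \<in> cells K (\<Delta>\<^sub>2 \<cdot> (\<delta>\<^sub>0 \<cdot> F)) (\<Delta>\<^sub>0 \<cdot> (\<delta>\<^sub>1 \<cdot> F))"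
  "\<sigma>\<^sub>1\<^sub>2 \<lhd> F \<in> cells K (\<Delta>\<^sub>2 \<cdot> (\<delta>\<^sub>1 \<cdot> F)) (\<Delta>\<^sub>1 \<cdot> (\<delta>\<^sub>1 \<cdot> F))"
  "\<nu> \<lhd> F \<in> cells K (\<epsilon> \<cdot> (\<delta>\<^sub>0 \<cdot> F)) F"
  "\<mu> \<lhd> F \<in> cells K F (\<epsilon> \<cdot> (\<delta>\<^sub>1 \<cdot> F))"
  "\<Delta>\<^sub>0 \<rhd> \<beta> \<in> cells K (\<Delta>\<^sub>0 \<cdot> (\<delta>\<^sub>1 \<cdot> F)) (\<Delta>\<^sub>0 \<cdot> (\<delta>\<^sub>0 \<cdot> F))"
  "\<Delta>\<^sub>1 \<rhd> \<beta> \<in> cells K (\<Delta>\<^sub>1 \<cdot> (\<delta>\<^sub>1 \<cdot> F)) (\<Delta>\<^sub>1 \<cdot> (\<delta>\<^sub>0 \<cdot> F))"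
  "\<Delta>\<^sub>2 \<rhd> \<beta> \<in> cells K (\<Delta>\<^sub>2 \<cdot> (\<delta>\<^sub>1 \<cdot> F)) (\<Delta>\<^sub>2 \<cdot> (\<delta>\<^sub>0 \<cdot> F))"
  "\<epsilon> \<rhd> \<beta> \<in> cells K (\<epsilon> \<cdot> (\<delta>\<^sub>1 \<cdot> F)) (\<epsilon> \<cdot> (\<delta>\<^sub>0 \<cdot> F))"
proof -
  note c = comp_hom
  have "one K A\<^sub>1 \<in> hom K A\<^sub>1 A\<^sub>1" and oneF: "one K A\<^sub>1 \<cdot> F = F"
    using homD[OF F] one_comp[of F] by (auto simp: hom_def typing)
  then show "\<nu> \<lhd> F \<in> cells K (\<epsilon> \<cdot> (\<delta>\<^sub>0 \<cdot> F)) F" "\<mu> \<lhd> F \<in> cells K F (\<epsilon> \<cdot> (\<delta>\<^sub>1 \<cdot> F))"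
    using whisker_right_cells[OF nu c[OF eps delta0] F] whisker_right_cells[OF mu _ F]
      comp_assoc_hom[OF eps _ F] delta0 delta1 by auto
  show "\<sigma>\<^sub>0\<^sub>1 \<lhd> F \<in> cells K (\<Delta>\<^sub>1 \<cdot> (\<delta>\<^sub>0 \<cdot> F)) (\<Delta>\<^sub>0 \<cdot> (\<delta>\<^sub>0 \<cdot> F))"
    "\<sigma>\<^sub>0\<^sub>2 \<lhd> F \<in> cells K (\<Delta>\<^sub>2 \<cdot> (\<delta>\<^sub>0 \<cdot> F)) (\<Delta>\<^sub>0 \<cdot> (\<delta>\<^sub>1 \<cdot> F))"
    "\<sigma>\<^sub>1\<^sub>2 \<lhd> F \<in> cells K (\<Delta>\<^sub>2 \<cdot> (\<delta>\<^sub>1 \<cdot> F)) (\<Delta>\<^sub>1 \<cdot> (\<delta>\<^sub>1 \<cdot> F))"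
    using whisker_right_cells[OF sigma01 c[OF Delta1 delta0] F]
      whisker_right_cells[OF sigma02 c[OF Delta2 delta0] F]
      whisker_right_cells[OF sigma12 c[OF Delta2 delta1] F]
      comp_assoc_hom[OF _ _ F] delta0 delta1 Delta0 Delta1 Delta2 by auto
qed (use whisker_left_cells[OF _ beta comp_hom[OF delta1 F]] Delta0 Delta1 Delta2 eps in blast)+

text \<open>In the dual 2-category the three factors of each law appear in the opposite bracketing.\<close>

lemma datum_brackets:
  "(\<sigma>\<^sub>0\<^sub>1 \<lhd> F) \<bullet> ((\<Delta>\<^sub>1 \<rhd> \<beta>) \<bullet> (\<sigma>\<^sub>1\<^sub>2 \<lhd> F)) = (\<sigma>\<^sub>0\<^sub>1 \<lhd> F) \<bullet> (\<Delta>\<^sub>1 \<rhd> \<beta>) \<bullet> (\<sigma>\<^sub>1\<^sub>2 \<lhd> F)"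
  "(\<Delta>\<^sub>0 \<rhd> \<beta>) \<bullet> ((\<sigma>\<^sub>0\<^sub>2 \<lhd> F) \<bullet> (\<Delta>\<^sub>2 \<rhd> \<beta>)) = (\<Delta>\<^sub>0 \<rhd> \<beta>) \<bullet> (\<sigma>\<^sub>0\<^sub>2 \<lhd> F) \<bullet> (\<Delta>\<^sub>2 \<rhd> \<beta>)"
  "(\<nu> \<lhd> F) \<bullet> ((\<epsilon> \<rhd> \<beta>) \<bullet> (\<mu> \<lhd> F)) = (\<nu> \<lhd> F) \<bullet> (\<epsilon> \<rhd> \<beta>) \<bullet> (\<mu> \<lhd> F)"
  using vcomp_assoc_cells datum_cells by blast+

lemma datum_whisker:
  assumes G: "G \<in> hom K T S"
  shows "((\<sigma>\<^sub>0\<^sub>1 \<lhd> F) \<bullet> (\<Delta>\<^sub>1 \<rhd> \<beta>) \<bullet> (\<sigma>\<^sub>1\<^sub>2 \<lhd> F)) \<lhd> G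
      = (\<sigma>\<^sub>0\<^sub>1 \<lhd> (F \<cdot> G)) \<bullet> (\<Delta>\<^sub>1 \<rhd> (\<beta> \<lhd> G)) \<bullet> (\<sigma>\<^sub>1\<^sub>2 \<lhd> (F \<cdot> G))"
    and "((\<Delta>\<^sub>0 \<rhd> \<beta>) \<bullet> (\<sigma>\<^sub>0\<^sub>2 \<lhd> F) \<bullet> (\<Delta>\<^sub>2 \<rhd> \<beta>)) \<lhd> G
      = (\<Delta>\<^sub>0 \<rhd> (\<beta> \<lhd> G)) \<bullet> (\<sigma>\<^sub>0\<^sub>2 \<lhd> (F \<cdot> G)) \<bullet> (\<Delta>\<^sub>2 \<rhd> (\<beta> \<lhd> G))"
    and "((\<nu> \<lhd> F) \<bullet> (\<epsilon> \<rhd> \<beta>) \<bullet> (\<mu> \<lhd> F)) \<lhd> G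
      = (\<nu> \<lhd> (F \<cdot> G)) \<bullet> (\<epsilon> \<rhd> (\<beta> \<lhd> G)) \<bullet> (\<mu> \<lhd> (F \<cdot> G))"
proof -
  note c = comp_hom
  have d1F: "\<delta>\<^sub>1 \<cdot> F \<in> hom K S A\<^sub>2" and d0F: "\<delta>\<^sub>0 \<cdot> F \<in> hom K S A\<^sub>2"
    using c[OF delta1 F] c[OF delta0 F] .
  note split = whisker_right_vcomp[OF _ _ _ G]
  have wr: "\<sigma>\<^sub>0\<^sub>1 \<lhd> (F \<cdot> G) = \<sigma>\<^sub>0\<^sub>1 \<lhd> F \<lhd> G" "\<sigma>\<^sub>0\<^sub>2 \<lhd> (F \<cdot> G) = \<sigma>\<^sub>0\<^sub>2 \<lhd> F \<lhd> G" "\<sigma>\<^sub>1\<^sub>2 \<lhd> (F \<cdot> G) = \<sigma>\<^sub>1\<^sub>2 \<lhd> F \<lhd> G"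
    "\<nu> \<lhd> (F \<cdot> G) = \<nu> \<lhd> F \<lhd> G" "\<mu> \<lhd> (F \<cdot> G) = \<mu> \<lhd> F \<lhd> G"
    using whisker_right_comp[OF sigma01 c[OF Delta1 delta0] F G]
      whisker_right_comp[OF sigma02 c[OF Delta2 delta0] F G]
      whisker_right_comp[OF sigma12 c[OF Delta2 delta1] F G]
      whisker_right_comp[OF nu c[OF eps delta0] F G]
      whisker_right_comp[OF mu cells_hom_dom[OF mu c[OF eps delta1]] F G] .
  have wl: "\<Delta>\<^sub>0 \<rhd> (\<beta> \<lhd> G) = (\<Delta>\<^sub>0 \<rhd> \<beta>) \<lhd> G" "\<Delta>\<^sub>1 \<rhd> (\<beta> \<lhd> G) = (\<Delta>\<^sub>1 \<rhd> \<beta>) \<lhd> G"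
    "\<Delta>\<^sub>2 \<rhd> (\<beta> \<lhd> G) = (\<Delta>\<^sub>2 \<rhd> \<beta>) \<lhd> G" "\<epsilon> \<rhd> (\<beta> \<lhd> G) = (\<epsilon> \<rhd> \<beta>) \<lhd> G"
    using whisker_left_right[OF _ beta d1F G] Delta0 Delta1 Delta2 eps by metis+
  show "((\<sigma>\<^sub>0\<^sub>1 \<lhd> F) \<bullet> (\<Delta>\<^sub>1 \<rhd> \<beta>) \<bullet> (\<sigma>\<^sub>1\<^sub>2 \<lhd> F)) \<lhd> G
      = (\<sigma>\<^sub>0\<^sub>1 \<lhd> (F \<cdot> G)) \<bullet> (\<Delta>\<^sub>1 \<rhd> (\<beta> \<lhd> G)) \<bullet> (\<sigma>\<^sub>1\<^sub>2 \<lhd> (F \<cdot> G))"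
    using split[OF datum_cells(3) vcomp_cells[OF datum_cells(7,1)] c[OF Delta2 d1F]]
      split[OF datum_cells(7,1) c[OF Delta1 d1F]]
    by (simp add: wr wl)
  show "((\<Delta>\<^sub>0 \<rhd> \<beta>) \<bullet> (\<sigma>\<^sub>0\<^sub>2 \<lhd> F) \<bullet> (\<Delta>\<^sub>2 \<rhd> \<beta>)) \<lhd> G
      = (\<Delta>\<^sub>0 \<rhd> (\<beta> \<lhd> G)) \<bullet> (\<sigma>\<^sub>0\<^sub>2 \<lhd> (F \<cdot> G)) \<bullet> (\<Delta>\<^sub>2 \<rhd> (\<beta> \<lhd> G))"
    using split[OF datum_cells(8) vcomp_cells[OF datum_cells(2,6)] c[OF Delta2 d1F]]
      split[OF datum_cells(2,6) c[OF Delta2 d0F]]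
    by (simp add: wr wl)
  show "((\<nu> \<lhd> F) \<bullet> (\<epsilon> \<rhd> \<beta>) \<bullet> (\<mu> \<lhd> F)) \<lhd> G
      = (\<nu> \<lhd> (F \<cdot> G)) \<bullet> (\<epsilon> \<rhd> (\<beta> \<lhd> G)) \<bullet> (\<mu> \<lhd> (F \<cdot> G))"
    using split[OF datum_cells(5) vcomp_cells[OF datum_cells(9,4)] F]
      split[OF datum_cells(9,4) c[OF eps d1F]]
    by (simp add: wr wl)
qed

end

lemma datum_is_cell:
  assumes "datum F \<beta>"
  shows "\<beta> \<in> cells K (\<delta>\<^sub>1 \<cdot> F) (\<delta>\<^sub>0 \<cdot> F)"
  using assms by (simp add: datum_def)

lemma datum_comp:
  assumes dat: "datum F \<beta>" and F: "F \<in> hom K S A\<^sub>1" and G: "G \<in> hom K T S"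
  shows "datum (F \<cdot> G) (\<beta> \<lhd> G)"
proof -
  note beta = datum_is_cell[OF dat]
  have "\<beta> \<lhd> G \<in> cells K (\<delta>\<^sub>1 \<cdot> (F \<cdot> G)) (\<delta>\<^sub>0 \<cdot> (F \<cdot> G))"
    using whisker_right_cells[OF beta comp_hom[OF delta1 F] G]
      comp_assoc_hom[OF delta1 F G] comp_assoc_hom[OF delta0 F G] by simp
  then show ?thesis
    using dat homD[OF comp_hom[OF F G]] whisker_right_one2[OF F G]
    by (simp add: datum_def datum_whisker[OF F beta G, symmetric])
qed

text \<open>
  A cell \<open>\<gamma> : E H \<Rightarrow> F\<close> that intertwines \<open>\<phi> * H\<close> with the descent datum \<open>\<beta>\<close> makes the laws for \<open>\<phi>\<close>,
  whiskered with \<open>H\<close>, agree with those for \<open>\<beta>\<close> after composition with the image of \<open>\<gamma>\<close>. The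
  cancellation hypotheses sit at the targets of the two laws, \<open>E\<close> and \<open>\<Delta>\<^sub>0 \<delta>\<^sub>0 E\<close>; in the application
  they are the uniqueness halves of Kan extensions.
\<close>

lemma datum_transfer:
  assumes dat: "datum F \<beta>" and E: "E \<in> hom K B A\<^sub>1" and H: "H \<in> hom K S B"
    and gamma: "\<gamma> \<in> cells K (E \<cdot> H) F"
    and phi: "\<phi> \<in> cells K (\<delta>\<^sub>1 \<cdot> E) (\<delta>\<^sub>0 \<cdot> E)"
    and square: "(\<delta>\<^sub>0 \<rhd> \<gamma>) \<bullet> (\<phi> \<lhd> H) = \<beta> \<bullet> (\<delta>\<^sub>1 \<rhd> \<gamma>)"
    and cancel: "\<And>R \<theta>\<^sub>1 \<theta>\<^sub>2. \<lbrakk>\<theta>\<^sub>1 \<in> cells K R E; \<theta>\<^sub>2 \<in> cells K R E; \<gamma> \<bullet> (\<theta>\<^sub>1 \<lhd> H) = \<gamma> \<bullet> (\<theta>\<^sub>2 \<lhd> H)\<rbrakk> \<Longrightarrow> \<theta>\<^sub>1 = \<theta>\<^sub>2"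
    and cancel3: "\<And>R \<theta>\<^sub>1 \<theta>\<^sub>2. \<lbrakk>\<theta>\<^sub>1 \<in> cells K R (\<Delta>\<^sub>0 \<cdot> \<delta>\<^sub>0 \<cdot> E); \<theta>\<^sub>2 \<in> cells K R (\<Delta>\<^sub>0 \<cdot> \<delta>\<^sub>0 \<cdot> E);
      ((\<Delta>\<^sub>0 \<cdot> \<delta>\<^sub>0) \<rhd> \<gamma>) \<bullet> (\<theta>\<^sub>1 \<lhd> H) = ((\<Delta>\<^sub>0 \<cdot> \<delta>\<^sub>0) \<rhd> \<gamma>) \<bullet> (\<theta>\<^sub>2 \<lhd> H)\<rbrakk> \<Longrightarrow> \<theta>\<^sub>1 = \<theta>\<^sub>2"
  shows "datum E \<phi>"
proof -
  note c = comp_hom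
  note EH = c[OF E H]
  note F = cells_hom_cod[OF gamma EH]
  note beta = datum_is_cell[OF dat]
  note hom = delta0 delta1 eps Delta0 Delta1 Delta2
  define \<phi>H where "\<phi>H = \<phi> \<lhd> H"
  have phiH: "\<phi>H \<in> cells K (\<delta>\<^sub>1 \<cdot> (E \<cdot> H)) (\<delta>\<^sub>0 \<cdot> (E \<cdot> H))"
    using whisker_right_cells[OF phi c[OF delta1 E] H]
      comp_assoc_hom[OF delta1 E H] comp_assoc_hom[OF delta0 E H] by (simp add: \<phi>H_def)
  have d1g: "\<delta>\<^sub>1 \<rhd> \<gamma> \<in> cells K (\<delta>\<^sub>1 \<cdot> (E \<cdot> H)) (\<delta>\<^sub>1 \<cdot> F)" and d0g: "\<delta>\<^sub>0 \<rhd> \<gamma> \<in> cells K (\<delta>\<^sub>0 \<cdot> (E \<cdot> H)) (\<delta>\<^sub>0 \<cdot> F)"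
    using whisker_left_cells[OF _ gamma EH] hom by blast+
  note d1EH = c[OF delta1 EH] and d0EH = c[OF delta0 EH]
  have wg: "X \<rhd> (\<delta>\<^sub>1 \<rhd> \<gamma>) \<in> cells K (X \<cdot> (\<delta>\<^sub>1 \<cdot> (E \<cdot> H))) (X \<cdot> (\<delta>\<^sub>1 \<cdot> F))"
    "X \<rhd> (\<delta>\<^sub>0 \<rhd> \<gamma>) \<in> cells K (X \<cdot> (\<delta>\<^sub>0 \<cdot> (E \<cdot> H))) (X \<cdot> (\<delta>\<^sub>0 \<cdot> F))"
    if "X \<in> hom K A\<^sub>2 Y" for X Y
    using whisker_left_cells[OF that d1g d1EH] whisker_left_cells[OF that d0g d0EH] .
  have wsq: "(X \<rhd> (\<delta>\<^sub>0 \<rhd> \<gamma>)) \<bullet> (X \<rhd> \<phi>H) = (X \<rhd> \<beta>) \<bullet> (X \<rhd> (\<delta>\<^sub>1 \<rhd> \<gamma>))" if "X \<in> hom K A\<^sub>2 Y" for X Y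
    using whisker_left_vcomp[OF that phiH d0g d1EH] whisker_left_vcomp[OF that d1g beta d1EH] square
    by (simp add: \<phi>H_def)
  note cE = datum_cells[OF EH phiH] and cF = datum_cells[OF F beta]
  \<comment> \<open>Each structure cell of the diagram is natural with respect to \<open>\<gamma>\<close>.\<close>
  have x01: "(\<Delta>\<^sub>0 \<rhd> (\<delta>\<^sub>0 \<rhd> \<gamma>)) \<bullet> (\<sigma>\<^sub>0\<^sub>1 \<lhd> (E \<cdot> H)) = (\<sigma>\<^sub>0\<^sub>1 \<lhd> F) \<bullet> (\<Delta>\<^sub>1 \<rhd> (\<delta>\<^sub>0 \<rhd> \<gamma>))"
    using whisker_exchange[OF sigma01 c[OF Delta1 delta0] gamma EH] whisker_left_comp[OF _ _ gamma EH] hom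
    by metis
  have x02: "(\<Delta>\<^sub>0 \<rhd> (\<delta>\<^sub>1 \<rhd> \<gamma>)) \<bullet> (\<sigma>\<^sub>0\<^sub>2 \<lhd> (E \<cdot> H)) = (\<sigma>\<^sub>0\<^sub>2 \<lhd> F) \<bullet> (\<Delta>\<^sub>2 \<rhd> (\<delta>\<^sub>0 \<rhd> \<gamma>))"
    using whisker_exchange[OF sigma02 c[OF Delta2 delta0] gamma EH] whisker_left_comp[OF _ _ gamma EH] hom
    by metis
  have x12: "(\<Delta>\<^sub>1 \<rhd> (\<delta>\<^sub>1 \<rhd> \<gamma>)) \<bullet> (\<sigma>\<^sub>1\<^sub>2 \<lhd> (E \<cdot> H)) = (\<sigma>\<^sub>1\<^sub>2 \<lhd> F) \<bullet> (\<Delta>\<^sub>2 \<rhd> (\<delta>\<^sub>1 \<rhd> \<gamma>))"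
    using whisker_exchange[OF sigma12 c[OF Delta2 delta1] gamma EH] whisker_left_comp[OF _ _ gamma EH] hom
    by metis
  have xn: "\<gamma> \<bullet> (\<nu> \<lhd> (E \<cdot> H)) = (\<nu> \<lhd> F) \<bullet> (\<epsilon> \<rhd> (\<delta>\<^sub>0 \<rhd> \<gamma>))"
    using whisker_exchange[OF nu c[OF eps delta0] gamma EH] whisker_left_comp[OF _ _ gamma EH] hom
      one_whisker[OF gamma EH] by metis
  have xm: "(\<epsilon> \<rhd> (\<delta>\<^sub>1 \<rhd> \<gamma>)) \<bullet> (\<mu> \<lhd> (E \<cdot> H)) = (\<mu> \<lhd> F) \<bullet> \<gamma>"
    using whisker_exchange[OF mu cells_hom_dom[OF mu c[OF eps delta1]] gamma EH]
      whisker_left_comp[OF _ _ gamma EH] hom one_whisker[OF gamma EH] by metis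
  note vc = vcomp_cells
  note w = datum_whisker[OF E phi H, folded \<phi>H_def]
  note pE = datum_cells[OF E phi]
  have "(\<sigma>\<^sub>0\<^sub>1 \<lhd> E) \<bullet> (\<Delta>\<^sub>1 \<rhd> \<phi>) \<bullet> (\<sigma>\<^sub>1\<^sub>2 \<lhd> E) = (\<Delta>\<^sub>0 \<rhd> \<phi>) \<bullet> (\<sigma>\<^sub>0\<^sub>2 \<lhd> E) \<bullet> (\<Delta>\<^sub>2 \<rhd> \<phi>)"
    (is "?l = ?r")
  proof (rule cancel3)
    show "?l \<in> cells K (\<Delta>\<^sub>2 \<cdot> (\<delta>\<^sub>1 \<cdot> E)) (\<Delta>\<^sub>0 \<cdot> \<delta>\<^sub>0 \<cdot> E)" "?r \<in> cells K (\<Delta>\<^sub>2 \<cdot> (\<delta>\<^sub>1 \<cdot> E)) (\<Delta>\<^sub>0 \<cdot> \<delta>\<^sub>0 \<cdot> E)"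
      using vc[OF pE(3) vc[OF pE(7,1)]] vc[OF pE(8) vc[OF pE(2,6)]] comp_assoc_hom[OF Delta0 delta0 E]
      by simp_all
    have "(\<Delta>\<^sub>0 \<rhd> (\<delta>\<^sub>0 \<rhd> \<gamma>)) \<bullet> (?l \<lhd> H)
        = (\<sigma>\<^sub>0\<^sub>1 \<lhd> F) \<bullet> (\<Delta>\<^sub>1 \<rhd> \<beta>) \<bullet> (\<sigma>\<^sub>1\<^sub>2 \<lhd> F) \<bullet> (\<Delta>\<^sub>2 \<rhd> (\<delta>\<^sub>1 \<rhd> \<gamma>))"
      unfolding w
      by (rule vcomp_slide[OF cE(3,7,1) cF(3,7,1) wg(1)[OF Delta2] wg(1)[OF Delta1] wg(2)[OF Delta1]
            wg(2)[OF Delta0] x12 wsq[OF Delta1] x01])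
    also have "\<dots> = (\<Delta>\<^sub>0 \<rhd> \<beta>) \<bullet> (\<sigma>\<^sub>0\<^sub>2 \<lhd> F) \<bullet> (\<Delta>\<^sub>2 \<rhd> \<beta>) \<bullet> (\<Delta>\<^sub>2 \<rhd> (\<delta>\<^sub>1 \<rhd> \<gamma>))"
      using dat by (simp add: datum_def)
    also have "\<dots> = (\<Delta>\<^sub>0 \<rhd> (\<delta>\<^sub>0 \<rhd> \<gamma>)) \<bullet> (?r \<lhd> H)"
      unfolding w
      by (rule vcomp_slide[OF cE(8,2,6) cF(8,2,6) wg(1)[OF Delta2] wg(2)[OF Delta2] wg(1)[OF Delta0]
            wg(2)[OF Delta0] wsq[OF Delta2] x02 wsq[OF Delta0], symmetric])
    finally show "((\<Delta>\<^sub>0 \<cdot> \<delta>\<^sub>0) \<rhd> \<gamma>) \<bullet> (?l \<lhd> H) = ((\<Delta>\<^sub>0 \<cdot> \<delta>\<^sub>0) \<rhd> \<gamma>) \<bullet> (?r \<lhd> H)"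
      using whisker_left_comp[OF Delta0 delta0 gamma EH] by simp
  qed
  moreover have "(\<nu> \<lhd> E) \<bullet> (\<epsilon> \<rhd> \<phi>) \<bullet> (\<mu> \<lhd> E) = one2 K E" (is "?l = _")
  proof (rule cancel)
    show "?l \<in> cells K E E" using vc[OF pE(5) vc[OF pE(9,4)]] .
    show "one2 K E \<in> cells K E E" using one2_cells[OF E] .
    have "\<gamma> \<bullet> (?l \<lhd> H) = (\<nu> \<lhd> F) \<bullet> (\<epsilon> \<rhd> \<beta>) \<bullet> (\<mu> \<lhd> F) \<bullet> \<gamma>"
      unfolding w
      by (rule vcomp_slide[OF cE(5,9,4) cF(5,9,4) gamma wg(1)[OF eps] wg(2)[OF eps] gamma xm wsq[OF eps] xn])
    also have "\<dots> = \<gamma>" using dat one2_vcomp_cells[OF gamma] by (simp add: datum_def)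
    finally show "\<gamma> \<bullet> (?l \<lhd> H) = \<gamma> \<bullet> (one2 K E \<lhd> H)"
      using whisker_right_one2[OF E H] vcomp_one2_cells[OF gamma] by simp
  qed
  ultimately show ?thesis using phi homD[OF E] by (simp add: datum_def)
qed

end

section \<open>Lax descent objects create right Kan extensions\<close>

locale lax_descent = descent_diagram +
  fixes L d \<psi>
  assumes forgetful_datum: "datum d \<psi>"
    and forgetful_hom: "d \<in> hom K L A\<^sub>1"
    and datum_factor: "\<lbrakk>datum F \<beta>; F \<in> hom K T A\<^sub>1\<rbrakk>
      \<Longrightarrow> \<exists>!F'. F' \<in> hom K T L \<and> d \<cdot> F' = F \<and> \<psi> \<lhd> F' = \<beta>"
    and cell_lift: "\<lbrakk>F\<^sub>1 \<in> hom K T L; F\<^sub>0 \<in> hom K T L; \<xi> \<in> cells K (d \<cdot> F\<^sub>1) (d \<cdot> F\<^sub>0);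
        (\<psi> \<lhd> F\<^sub>0) \<bullet> (\<delta>\<^sub>1 \<rhd> \<xi>) = (\<delta>\<^sub>0 \<rhd> \<xi>) \<bullet> (\<psi> \<lhd> F\<^sub>1)\<rbrakk>
      \<Longrightarrow> \<exists>!\<xi>'. \<xi>' \<in> cells K F\<^sub>1 F\<^sub>0 \<and> d \<rhd> \<xi>' = \<xi>"
begin

lemma psi_cells: "\<psi> \<in> cells K (\<delta>\<^sub>1 \<cdot> d) (\<delta>\<^sub>0 \<cdot> d)"
  using datum_is_cell[OF forgetful_datum] .

lemma psi_whisker:
  assumes "F \<in> hom K T L"
  shows "\<psi> \<lhd> F \<in> cells K (\<delta>\<^sub>1 \<cdot> (d \<cdot> F)) (\<delta>\<^sub>0 \<cdot> (d \<cdot> F))"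
  using whisker_right_cells[OF psi_cells comp_hom[OF delta1 forgetful_hom] assms]
    comp_assoc_hom[OF delta1 forgetful_hom assms] comp_assoc_hom[OF delta0 forgetful_hom assms]
  by simp

lemma psi_natural:
  assumes "F\<^sub>1 \<in> hom K T L" "\<xi> \<in> cells K F\<^sub>1 F\<^sub>0"
  shows "(\<psi> \<lhd> F\<^sub>0) \<bullet> (\<delta>\<^sub>1 \<rhd> (d \<rhd> \<xi>)) = (\<delta>\<^sub>0 \<rhd> (d \<rhd> \<xi>)) \<bullet> (\<psi> \<lhd> F\<^sub>1)"
  using whisker_exchange[OF psi_cells comp_hom[OF delta1 forgetful_hom] assms(2,1)]
    whisker_left_comp[OF delta1 forgetful_hom assms(2,1)]
    whisker_left_comp[OF delta0 forgetful_hom assms(2,1)] by simp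

text \<open>
  The lifting property applies to the image \<open>d * \<xi>\<close> of any cell, since it is compatible with \<open>\<psi>\<close> by
  naturality; its uniqueness part then recovers \<open>\<xi>\<close>.
\<close>

lemma forgetful_faithful:
  assumes F: "F\<^sub>1 \<in> hom K T L" and xi: "\<xi> \<in> cells K F\<^sub>1 F\<^sub>0" and xi': "\<xi>' \<in> cells K F\<^sub>1 F\<^sub>0"
    and eq: "d \<rhd> \<xi> = d \<rhd> \<xi>'"
  shows "\<xi> = \<xi>'"
  using cell_lift[OF F cells_hom_cod[OF xi F] whisker_left_cells[OF forgetful_hom xi F] psi_natural[OF F xi]]
    xi xi' eq by metis

text \<open>
  Given \<open>\<tau> : R H \<Rightarrow> J\<close>, the cell \<open>d * \<tau>\<close> factors through \<open>d * \<gamma>\<close> by some \<open>\<xi> : d R \<Rightarrow> d E\<close>, and the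
  task is to lift \<open>\<xi>\<close> along \<open>d\<close>. Its compatibility with \<open>\<psi>\<close> is an equation between cells into
  \<open>\<delta>\<^sub>0 d E\<close>, which the cancellation hypothesis reduces to the compatibility of \<open>d * \<tau>\<close>, where it
  is naturality of \<open>\<psi>\<close>. Injectivity is inherited from that for \<open>d * \<gamma>\<close>, because
  \<open>d\<close> is faithful on 2-cells.
\<close>

lemma is_ran_lift:
  assumes H: "H \<in> hom K S B" and J: "J \<in> hom K S L" and E: "E \<in> hom K B L"
    and gamma: "\<gamma> \<in> cells K (E \<cdot> H) J"
    and ran: "is_ran K H (d \<cdot> J) (d \<cdot> E) (d \<rhd> \<gamma>)"
    and cancel: "\<And>R \<theta>\<^sub>1 \<theta>\<^sub>2. \<lbrakk>\<theta>\<^sub>1 \<in> cells K R (\<delta>\<^sub>0 \<cdot> (d \<cdot> E)); \<theta>\<^sub>2 \<in> cells K R (\<delta>\<^sub>0 \<cdot> (d \<cdot> E));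
      (\<delta>\<^sub>0 \<rhd> (d \<rhd> \<gamma>)) \<bullet> (\<theta>\<^sub>1 \<lhd> H) = (\<delta>\<^sub>0 \<rhd> (d \<rhd> \<gamma>)) \<bullet> (\<theta>\<^sub>2 \<lhd> H)\<rbrakk> \<Longrightarrow> \<theta>\<^sub>1 = \<theta>\<^sub>2"
  shows "is_ran K H J E \<gamma>"
proof -
  note c = comp_hom and vc = vcomp_cells and as = vcomp_assoc_cells
  note EH = c[OF E H]
  note dEH = c[OF forgetful_hom EH]
  note dg = whisker_left_cells[OF forgetful_hom gamma EH]
  have d_push: "d \<rhd> (\<gamma> \<bullet> (\<beta> \<lhd> H)) = (d \<rhd> \<gamma>) \<bullet> ((d \<rhd> \<beta>) \<lhd> H)"
    if "R \<in> hom K B L" "\<beta> \<in> cells K R E" for R \<beta>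
    using whisker_left_vcomp[OF forgetful_hom whisker_right_cells[OF that(2,1) H] gamma c[OF that(1) H]]
      whisker_left_right[OF forgetful_hom that(2,1) H] by simp
  have "bij_betw (\<lambda>\<beta>. \<gamma> \<bullet> (\<beta> \<lhd> H)) (cells K R E) (cells K (R \<cdot> H) J)" if R: "R \<in> hom K B L" for R
    unfolding bij_betw_def
  proof (intro conjI inj_onI equalityI subsetI)
    fix \<beta>\<^sub>1 \<beta>\<^sub>2
    assume \<beta>: "\<beta>\<^sub>1 \<in> cells K R E" "\<beta>\<^sub>2 \<in> cells K R E" and eq: "\<gamma> \<bullet> (\<beta>\<^sub>1 \<lhd> H) = \<gamma> \<bullet> (\<beta>\<^sub>2 \<lhd> H)"
    have "d \<rhd> \<beta>\<^sub>1 = d \<rhd> \<beta>\<^sub>2"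
      using is_ran_cancel[OF ran] whisker_left_cells[OF forgetful_hom _ R] \<beta> d_push[OF R] eq by metis
    then show "\<beta>\<^sub>1 = \<beta>\<^sub>2" using forgetful_faithful[OF R \<beta>] by simp
  next
    fix x assume "x \<in> (\<lambda>\<beta>. \<gamma> \<bullet> (\<beta> \<lhd> H)) ` cells K R E"
    then show "x \<in> cells K (R \<cdot> H) J"
      using vc[OF whisker_right_cells[OF _ R H] gamma] by auto
  next
    note RH = c[OF R H] and dR = c[OF forgetful_hom R]
    fix \<tau> assume tau: "\<tau> \<in> cells K (R \<cdot> H) J"
    note dt = whisker_left_cells[OF forgetful_hom tau RH]
    have "d \<rhd> \<tau> \<in> cells K (d \<cdot> R \<cdot> H) (d \<cdot> J)"
      using dt comp_assoc_hom[OF forgetful_hom R H] by simp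
    moreover have "d \<cdot> R \<in> hom K (trg K H) (trg K (d \<cdot> J))"
      using dR homD[OF H] homD[OF c[OF forgetful_hom J]] by simp
    ultimately obtain \<xi> where xi: "\<xi> \<in> cells K (d \<cdot> R) (d \<cdot> E)" and xi_eq: "(d \<rhd> \<gamma>) \<bullet> (\<xi> \<lhd> H) = d \<rhd> \<tau>"
      using is_ran_factor[OF ran] by metis
    have xiH: "\<xi> \<lhd> H \<in> cells K (d \<cdot> (R \<cdot> H)) (d \<cdot> (E \<cdot> H))"
      using whisker_right_cells[OF xi dR H] comp_assoc_hom[OF forgetful_hom _ H] R E by auto
    have d1xi: "\<delta>\<^sub>1 \<rhd> \<xi> \<in> cells K (\<delta>\<^sub>1 \<cdot> (d \<cdot> R)) (\<delta>\<^sub>1 \<cdot> (d \<cdot> E))"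
      and d0xi: "\<delta>\<^sub>0 \<rhd> \<xi> \<in> cells K (\<delta>\<^sub>0 \<cdot> (d \<cdot> R)) (\<delta>\<^sub>0 \<cdot> (d \<cdot> E))"
      using whisker_left_cells[OF _ xi dR] delta0 delta1 by auto
    have dxiH: "X \<rhd> (\<xi> \<lhd> H) \<in> cells K (X \<cdot> (d \<cdot> (R \<cdot> H))) (X \<cdot> (d \<cdot> (E \<cdot> H)))"
      and dgam: "X \<rhd> (d \<rhd> \<gamma>) \<in> cells K (X \<cdot> (d \<cdot> (E \<cdot> H))) (X \<cdot> (d \<cdot> J))"
      and fact: "(X \<rhd> (d \<rhd> \<gamma>)) \<bullet> (X \<rhd> (\<xi> \<lhd> H)) = X \<rhd> (d \<rhd> \<tau>)"
      if "X \<in> hom K A\<^sub>1 A\<^sub>2" for X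
      using whisker_left_cells[OF that xiH c[OF forgetful_hom RH]] whisker_left_cells[OF that dg dEH]
        whisker_left_vcomp[OF that xiH dg c[OF forgetful_hom RH]] xi_eq by simp_all
    have psiH: "\<psi> \<lhd> F \<lhd> H = \<psi> \<lhd> (F \<cdot> H)" if "F \<in> hom K B L" for F
      using whisker_right_comp[OF psi_cells c[OF delta1 forgetful_hom] that H] by simp
    have "(\<psi> \<lhd> E) \<bullet> (\<delta>\<^sub>1 \<rhd> \<xi>) = (\<delta>\<^sub>0 \<rhd> \<xi>) \<bullet> (\<psi> \<lhd> R)"
    proof (rule cancel)
      note pE = psi_whisker[OF E] and pR = psi_whisker[OF R]
        and pEH = psi_whisker[OF EH] and pRH = psi_whisker[OF RH]
      show "(\<psi> \<lhd> E) \<bullet> (\<delta>\<^sub>1 \<rhd> \<xi>) \<in> cells K (\<delta>\<^sub>1 \<cdot> (d \<cdot> R)) (\<delta>\<^sub>0 \<cdot> (d \<cdot> E))"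
        "(\<delta>\<^sub>0 \<rhd> \<xi>) \<bullet> (\<psi> \<lhd> R) \<in> cells K (\<delta>\<^sub>1 \<cdot> (d \<cdot> R)) (\<delta>\<^sub>0 \<cdot> (d \<cdot> E))"
        using vc[OF d1xi pE] vc[OF pR d0xi] .
      have "((\<psi> \<lhd> E) \<bullet> (\<delta>\<^sub>1 \<rhd> \<xi>)) \<lhd> H = (\<psi> \<lhd> (E \<cdot> H)) \<bullet> (\<delta>\<^sub>1 \<rhd> (\<xi> \<lhd> H))"
        using whisker_right_vcomp[OF d1xi pE c[OF delta1 dR] H] psiH[OF E]
          whisker_left_right[OF delta1 xi dR H] by simp
      then have "(\<delta>\<^sub>0 \<rhd> (d \<rhd> \<gamma>)) \<bullet> (((\<psi> \<lhd> E) \<bullet> (\<delta>\<^sub>1 \<rhd> \<xi>)) \<lhd> H)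
          = (\<psi> \<lhd> J) \<bullet> (\<delta>\<^sub>1 \<rhd> (d \<rhd> \<gamma>)) \<bullet> (\<delta>\<^sub>1 \<rhd> (\<xi> \<lhd> H))"
        using as[OF dxiH[OF delta1] pEH dgam[OF delta0]] psi_natural[OF EH gamma] by simp
      also have "\<dots> = (\<psi> \<lhd> J) \<bullet> (\<delta>\<^sub>1 \<rhd> (d \<rhd> \<tau>))"
        using as[OF dxiH[OF delta1] dgam[OF delta1] psi_whisker[OF J]] fact[OF delta1] by simp
      also have "\<dots> = (\<delta>\<^sub>0 \<rhd> (d \<rhd> \<gamma>)) \<bullet> (\<delta>\<^sub>0 \<rhd> (\<xi> \<lhd> H)) \<bullet> (\<psi> \<lhd> (R \<cdot> H))"
        using psi_natural[OF RH tau] fact[OF delta0] by simp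
      also have "\<dots> = (\<delta>\<^sub>0 \<rhd> (d \<rhd> \<gamma>)) \<bullet> (((\<delta>\<^sub>0 \<rhd> \<xi>) \<bullet> (\<psi> \<lhd> R)) \<lhd> H)"
        using as[OF pRH dxiH[OF delta0] dgam[OF delta0]] psiH[OF R]
          whisker_right_vcomp[OF pR d0xi c[OF delta1 dR] H]
          whisker_left_right[OF delta0 xi dR H] by simp
      finally show "(\<delta>\<^sub>0 \<rhd> (d \<rhd> \<gamma>)) \<bullet> (((\<psi> \<lhd> E) \<bullet> (\<delta>\<^sub>1 \<rhd> \<xi>)) \<lhd> H)
          = (\<delta>\<^sub>0 \<rhd> (d \<rhd> \<gamma>)) \<bullet> (((\<delta>\<^sub>0 \<rhd> \<xi>) \<bullet> (\<psi> \<lhd> R)) \<lhd> H)" .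
    qed
    from cell_lift[OF R E xi this] obtain \<xi>' where xi': "\<xi>' \<in> cells K R E" "d \<rhd> \<xi>' = \<xi>" by blast
    have "\<gamma> \<bullet> (\<xi>' \<lhd> H) = \<tau>"
      by (rule forgetful_faithful[OF RH vc[OF whisker_right_cells[OF xi'(1) R H] gamma] tau])
        (use d_push[OF R xi'(1)] xi'(2) xi_eq in simp)
    then show "\<tau> \<in> (\<lambda>\<beta>. \<gamma> \<bullet> (\<beta> \<lhd> H)) ` cells K R E" using xi'(1) by blast
  qed
  then show ?thesis using homD[OF H] homD[OF J] E gamma by (auto simp: is_ran_def)
qed

theorem creates_ran_forgetful:
  assumes J: "J \<in> hom K S L" and H: "H \<in> hom K S B"
    and ran: "is_ran K H (d \<cdot> J) E \<gamma>"
    and pres: "preserves_ran K \<delta>\<^sub>0 H (d \<cdot> J) E \<gamma>"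
    and pres3: "preserves_ran K (\<Delta>\<^sub>0 \<cdot> \<delta>\<^sub>0) H (d \<cdot> J) E \<gamma>"
  shows "creates_ran K d H J"
proof -
  note c = comp_hom
  note dJ = c[OF forgetful_hom J]
  note dat = datum_comp[OF forgetful_datum forgetful_hom J]
  note beta = datum_is_cell[OF dat]
  have [simp]: "trg K H = B" "trg K (d \<cdot> J) = A\<^sub>1" "trg K J = L" using homD[OF H] homD[OF dJ] homD[OF J] by auto
  have E: "E \<in> hom K B A\<^sub>1" and gamma: "\<gamma> \<in> cells K (E \<cdot> H) (d \<cdot> J)"
    using is_ranD(1,2)[OF ran] by simp_all
  note EH = c[OF E H] and d1E = c[OF delta1 E]
  have cancel: "\<theta>\<^sub>1 = \<theta>\<^sub>2"
    if "is_ran K H (d \<cdot> J) E' \<gamma>'" "\<theta>\<^sub>1 \<in> cells K R (\<delta>\<^sub>0 \<cdot> E')" "\<theta>\<^sub>2 \<in> cells K R (\<delta>\<^sub>0 \<cdot> E')"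
      "(\<delta>\<^sub>0 \<rhd> \<gamma>') \<bullet> (\<theta>\<^sub>1 \<lhd> H) = (\<delta>\<^sub>0 \<rhd> \<gamma>') \<bullet> (\<theta>\<^sub>2 \<lhd> H)"
    for E' \<gamma>' R \<theta>\<^sub>1 \<theta>\<^sub>2
    using preserved_ran_cancel[OF ran that(1) pres H dJ delta0 that(2-4)] .
  have "reflects_ran K d H J"
    unfolding reflects_ran_def
    using is_ran_lift[OF H J] cancel by auto
  moreover have "\<exists>E' \<gamma>'. is_ran K H J E' \<gamma>' \<and> preserves_ran K d H J E' \<gamma>'"
  proof -
    have d1g: "\<delta>\<^sub>1 \<rhd> \<gamma> \<in> cells K (\<delta>\<^sub>1 \<cdot> E \<cdot> H) (\<delta>\<^sub>1 \<cdot> (d \<cdot> J))"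
      using whisker_left_cells[OF delta1 gamma EH] comp_assoc_hom[OF delta1 E H] by simp
    have pres': "is_ran K H (\<delta>\<^sub>0 \<cdot> (d \<cdot> J)) (\<delta>\<^sub>0 \<cdot> E) (\<delta>\<^sub>0 \<rhd> \<gamma>)"
      using pres by (simp add: preserves_ran_def)
    have "\<delta>\<^sub>1 \<cdot> E \<in> hom K (trg K H) (trg K (\<delta>\<^sub>0 \<cdot> (d \<cdot> J)))"
      using d1E homD[OF c[OF delta0 dJ]] by simp
    then obtain \<phi> where phi: "\<phi> \<in> cells K (\<delta>\<^sub>1 \<cdot> E) (\<delta>\<^sub>0 \<cdot> E)"
      and square: "(\<delta>\<^sub>0 \<rhd> \<gamma>) \<bullet> (\<phi> \<lhd> H) = (\<psi> \<lhd> J) \<bullet> (\<delta>\<^sub>1 \<rhd> \<gamma>)"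
      using is_ran_factor[OF pres' _ vcomp_cells[OF d1g beta]] by blast
    \<comment> \<open>Preservation by \<open>\<Delta>\<^sub>0 \<cdot> \<delta>\<^sub>0\<close> gives the cancellation needed for the cocycle law.\<close>
    have "datum E \<phi>"
      by (rule datum_transfer[OF dat E H gamma phi square])
        (use is_ran_cancel[OF ran] is_ran_cancel[OF pres3[unfolded preserves_ran_def]] in blast)+
    from datum_factor[OF this E] obtain E'
      where E': "E' \<in> hom K B L" "d \<cdot> E' = E" "\<psi> \<lhd> E' = \<phi>" by blast
    note E'H = c[OF E'(1) H]
    have assoc: "d \<cdot> (E' \<cdot> H) = E \<cdot> H" using comp_assoc_hom[OF forgetful_hom E'(1) H] E'(2) by simp
    have "\<psi> \<lhd> (E' \<cdot> H) = \<phi> \<lhd> H"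
      using whisker_right_comp[OF psi_cells c[OF delta1 forgetful_hom] E'(1) H] E'(3) by simp
    then obtain \<gamma>' where g': "\<gamma>' \<in> cells K (E' \<cdot> H) J" "d \<rhd> \<gamma>' = \<gamma>"
      using cell_lift[OF E'H J, of \<gamma>] gamma assoc square by auto
    have "is_ran K H J E' \<gamma>'"
      using is_ran_lift[OF H J E'(1) g'(1)] ran cancel[OF ran] by (simp add: E'(2) g'(2))
    then show ?thesis using ran E'(2) g'(2) by (auto simp: preserves_ran_def)
  qed
  ultimately show ?thesis by (simp add: creates_ran_def)
qed

end


section \<open>Reversing 2-cells\<close>

text \<open>
  The dual 2-category that reverses 2-cells and keeps the direction of 1-cells, so that right Kan
  extensions become left ones.
\<close>

definition co :: "('o, 'a, 'c, 'z) two_cat_scheme \<Rightarrow> ('o, 'a, 'c, 'z) two_cat_scheme" where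
  "co K = K\<lparr>dom2 := cod2 K, cod2 := dom2 K, vcomp := (\<lambda>\<beta> \<alpha>. \<alpha> \<bullet>\<^bsub>K\<^esub> \<beta>)\<rparr>"

lemma co_simps [simp]:
  "Obj (co K) = Obj K" "Arr (co K) = Arr K" "src (co K) = src K" "trg (co K) = trg K"
  "one (co K) = one K" "comp1 (co K) = comp1 K" "Cell (co K) = Cell K"
  "dom2 (co K) = cod2 K" "cod2 (co K) = dom2 K" "one2 (co K) = one2 K" "hcomp (co K) = hcomp K"
  "vcomp (co K) \<beta> \<alpha> = vcomp K \<alpha> \<beta>"
  by (simp_all add: co_def)

lemma hom_co [simp]: "hom (co K) x y = hom K x y"
  by (simp add: hom_def)

lemma cells_co [simp]: "cells (co K) f g = cells K g f"
  by (auto simp: cells_def)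

lemma whisker_co [simp]:
  "whisker_left (co K) f \<alpha> = whisker_left K f \<alpha>" "whisker_right (co K) \<alpha> f = whisker_right K \<alpha> f"
  by (simp_all add: whisker_left_def whisker_right_def)

lemma is_ran_co: "is_ran (co K) H J E \<eta> = is_lan K H J E \<eta>"
  by (simp add: is_ran_def is_lan_def)

lemma preserves_ran_co: "preserves_ran (co K) G H J E \<eta> = preserves_lan K G H J E \<eta>"
  by (simp add: preserves_ran_def preserves_lan_def is_ran_co)

lemma creates_ran_co: "creates_ran (co K) G H J = creates_lan K G H J"
  by (simp add: creates_ran_def creates_lan_def reflects_ran_def reflects_lan_def is_ran_co preserves_ran_co)

lemma (in two_category) two_category_co: "two_category (co K)"
  by unfold_locales
    (simp_all add: typing comp_one one_comp comp_assoc vcomp_one2 one2_vcomp vcomp_assoc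
      hcomp_one2_one2 interchange hcomp_one one_hcomp hcomp_assoc)

text \<open>
  Reversal of the ordinals exchanges \<open>\<delta>\<^sub>0\<close> with \<open>\<delta>\<^sub>1\<close> and \<open>\<Delta>\<^sub>0\<close> with \<open>\<Delta>\<^sub>2\<close>. Under this exchange the
  reversed \<open>\<sigma>\<^sub>1\<^sub>2\<close> has the type required of \<open>\<sigma>\<^sub>0\<^sub>1\<close> and conversely, \<open>\<sigma>\<^sub>0\<^sub>2\<close> has its own type, and the
  reversed \<open>\<mu>\<close> has the type required of \<open>\<nu>\<close>.
\<close>

lemma (in descent_diagram) descent_diagram_co:
  "descent_diagram (co K) A\<^sub>1 A\<^sub>2 A\<^sub>3 \<delta>\<^sub>1 \<delta>\<^sub>0 \<epsilon> \<Delta>\<^sub>2 \<Delta>\<^sub>1 \<Delta>\<^sub>0 \<sigma>\<^sub>1\<^sub>2 \<sigma>\<^sub>0\<^sub>2 \<sigma>\<^sub>0\<^sub>1 \<mu> \<nu>"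
  using two_category_co
  by (simp add: descent_diagram_def descent_diagram_axioms_def delta0 delta1 eps Delta0 Delta1 Delta2
      sigma01 sigma02 sigma12 nu mu)

lemma (in descent_diagram) datum_co:
  "descent_diagram.datum (co K) A\<^sub>1 \<delta>\<^sub>1 \<delta>\<^sub>0 \<epsilon> \<Delta>\<^sub>2 \<Delta>\<^sub>1 \<Delta>\<^sub>0 \<sigma>\<^sub>1\<^sub>2 \<sigma>\<^sub>0\<^sub>2 \<sigma>\<^sub>0\<^sub>1 \<mu> \<nu> F \<beta> \<longleftrightarrow> datum F \<beta>"
proof -
  have F: "F \<in> hom K (src K F) A\<^sub>1" if "F \<in> Arr K" "trg K F = A\<^sub>1" using that by (simp add: hom_def)
  show ?thesis
    unfolding descent_diagram.datum_def[OF descent_diagram_co] datum_def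
    using datum_brackets[OF F] by auto
qed

lemma (in lax_descent) lax_descent_co:
  "lax_descent (co K) A\<^sub>1 A\<^sub>2 A\<^sub>3 \<delta>\<^sub>1 \<delta>\<^sub>0 \<epsilon> \<Delta>\<^sub>2 \<Delta>\<^sub>1 \<Delta>\<^sub>0 \<sigma>\<^sub>1\<^sub>2 \<sigma>\<^sub>0\<^sub>2 \<sigma>\<^sub>0\<^sub>1 \<mu> \<nu> L d \<psi>"
  unfolding lax_descent_def lax_descent_axioms_def datum_co
  using descent_diagram_co forgetful_datum forgetful_hom datum_factor cell_lift by simp


section \<open>The descent diagram of a pseudofunctor\<close>

context two_category
begin

lemma inv2_inverse_cells:
  assumes "invertible K \<alpha>"
  shows "inverse_cells K \<alpha> (inv2 K \<alpha>)"
proof -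
  obtain \<beta> where \<beta>: "inverse_cells K \<alpha> \<beta>" using assms by (auto simp: invertible_def)
  have "\<beta>' = \<beta>" if "inverse_cells K \<alpha> \<beta>'" for \<beta>'
  proof -
    have "\<beta>' = \<beta>' \<bullet> (\<alpha> \<bullet> \<beta>)"
      using \<beta> that vcomp_one2_cells[of \<beta>'] by (auto simp: inverse_cells_def)
    also have "\<dots> = (\<beta>' \<bullet> \<alpha>) \<bullet> \<beta>"
      using \<beta> that by (intro vcomp_assoc) (auto simp: inverse_cells_def cells_def)
    also have "\<dots> = \<beta>"
      using \<beta> that one2_vcomp_cells[of \<beta>] by (auto simp: inverse_cells_def)
    finally show ?thesis .
  qed
  then show ?thesis unfolding inv2_def using theI[of "inverse_cells K \<alpha>"] \<beta> by blast
qed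

lemma inv2_cells:
  assumes "invertible K \<alpha>" "\<alpha> \<in> cells K f g"
  shows "inv2 K \<alpha> \<in> cells K g f" "invertible K (inv2 K \<alpha>)"
  using inv2_inverse_cells[OF assms(1)] assms(2)
  by (auto simp: inverse_cells_def cells_def invertible_def)

lemma invertible_vcomp:
  assumes "invertible K \<alpha>" "\<alpha> \<in> cells K f g" "invertible K \<beta>" "\<beta> \<in> cells K g h"
  shows "invertible K (\<beta> \<bullet> \<alpha>)"
proof -
  note as = vcomp_assoc_cells and vc = vcomp_cells
  define \<alpha>' \<beta>' where "\<alpha>' = inv2 K \<alpha>" and "\<beta>' = inv2 K \<beta>"
  have \<alpha>': "\<alpha>' \<in> cells K g f" and \<beta>': "\<beta>' \<in> cells K h g"
    using inv2_cells assms by (auto simp: \<alpha>'_def \<beta>'_def)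
  have inv: "\<alpha>' \<bullet> \<alpha> = one2 K f" "\<alpha> \<bullet> \<alpha>' = one2 K g" "\<beta>' \<bullet> \<beta> = one2 K g" "\<beta> \<bullet> \<beta>' = one2 K h"
    using inv2_inverse_cells[OF assms(1)] inv2_inverse_cells[OF assms(3)] assms
    by (auto simp: \<alpha>'_def \<beta>'_def inverse_cells_def cells_def)
  have "(\<alpha>' \<bullet> \<beta>') \<bullet> (\<beta> \<bullet> \<alpha>) = one2 K f"
    using as[OF assms(2,4) vc[OF \<beta>' \<alpha>']] as[OF assms(4) \<beta>' \<alpha>'] vcomp_one2_cells[OF \<alpha>'] by (simp add: inv)
  moreover have "(\<beta> \<bullet> \<alpha>) \<bullet> (\<alpha>' \<bullet> \<beta>') = one2 K h"
    using as[OF \<beta>' \<alpha>' vc[OF assms(2,4)]] as[OF \<alpha>' assms(2,4)] vcomp_one2_cells[OF assms(4)] by (simp add: inv)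
  ultimately have "inverse_cells K (\<beta> \<bullet> \<alpha>) (\<alpha>' \<bullet> \<beta>')"
    using vc[OF assms(2,4)] vc[OF \<beta>' \<alpha>'] by (auto simp: inverse_cells_def cells_def)
  then show ?thesis by (auto simp: invertible_def)
qed

end

lemma descent_diagram_pseudofunctor:
  assumes "pseudofunctor Delta3 K P"
  shows "descent_diagram K (fobj P 1) (fobj P 2) (fobj P 3) (farr P d0) (farr P d1) (farr P s0)
    (farr P D0) (farr P D1) (farr P D2) (sigma01 K P) (sigma02 K P) (sigma12 K P) (nu0 K P) (inv2 K (nu1 K P))"
proof -
  interpret pseudofunctor Delta3 K P by fact
  have Arr: "d0 \<in> Arr Delta3" "d1 \<in> Arr Delta3" "s0 \<in> Arr Delta3" "D0 \<in> Arr Delta3" "D1 \<in> Arr Delta3"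
    "D2 \<in> Arr Delta3"
    by (simp_all add: Delta3_def Delta3_arr.gen)
  have src_trg: "src Delta3 d0 = 1" "src Delta3 d1 = 1" "src Delta3 s0 = 2" "src Delta3 D0 = 2"
    "src Delta3 D1 = 2" "src Delta3 D2 = 2" "trg Delta3 d0 = 2" "trg Delta3 d1 = 2" "trg Delta3 s0 = 1"
    "trg Delta3 D0 = 3" "trg Delta3 D1 = 3" "trg Delta3 D2 = 3"
    by (simp_all add: Delta3_def FinOrd_def d0_def d1_def s0_def D0_def D1_def D2_def)
  have Obj: "1 \<in> Obj Delta3" by (simp add: Delta3_def)
  have compose: "inv2 K \<beta> \<bullet>\<^bsub>K\<^esub> \<alpha> \<in> cells K f h" "invertible K (inv2 K \<beta> \<bullet>\<^bsub>K\<^esub> \<alpha>)"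
    if "\<alpha> \<in> cells K f g" "invertible K \<alpha>" "\<beta> \<in> cells K h g" "invertible K \<beta>" for \<alpha> \<beta> f g h
    using K.vcomp_cells[OF that(1) K.inv2_cells(1)[OF that(4,3)]]
      K.invertible_vcomp[OF that(2,1) K.inv2_cells(2,1)[OF that(4,3)]] .
  have fcomp: "fcomp P h g \<in> cells K (farr P h \<cdot>\<^bsub>K\<^esub> farr P g) (farr P (h \<cdot>\<^bsub>Delta3\<^esub> g))"
    "invertible K (fcomp P h g)"
    if "g \<in> {d0, d1}" "h \<in> {s0, D0, D1, D2}" for g h
    using that fcomp_cells[of g h] fcomp_invertible[of g h] Arr src_trg by auto
  have sigma: "inv2 K (fcomp P h' g') \<bullet>\<^bsub>K\<^esub> fcomp P h g
      \<in> cells K (farr P h \<cdot>\<^bsub>K\<^esub> farr P g) (farr P h' \<cdot>\<^bsub>K\<^esub> farr P g')"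
    if "g \<in> {d0, d1}" "g' \<in> {d0, d1}" "h \<in> {D0, D1, D2}" "h' \<in> {D0, D1, D2}"
      "h \<cdot>\<^bsub>Delta3\<^esub> g = h' \<cdot>\<^bsub>Delta3\<^esub> g'"
    for g g' h h'
    by (rule compose(1)[of _ _ "farr P (h \<cdot>\<^bsub>Delta3\<^esub> g)"])
      (use that fcomp[of g h] fcomp[of g' h'] in auto)
  note fone = fone_cells[OF Obj] fone_invertible[OF Obj]
  have "nu1 K P \<in> cells K (farr P s0 \<cdot>\<^bsub>K\<^esub> farr P d1) (one K (fobj P 1))" "invertible K (nu1 K P)"
    unfolding nu1_def
    using compose[OF _ _ fone] fcomp[of d1 s0] Delta3_relations by auto
  note nu1 = K.inv2_cells(1)[OF this(2,1)]
  have nu0: "nu0 K P \<in> cells K (farr P s0 \<cdot>\<^bsub>K\<^esub> farr P d0) (one K (fobj P 1))"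
    unfolding nu0_def
    using compose[OF _ _ fone] fcomp[of d0 s0] Delta3_relations by auto
  show ?thesis
    unfolding descent_diagram_def descent_diagram_axioms_def
    using K.two_category_axioms farr_hom[OF Arr(1)] farr_hom[OF Arr(2)] farr_hom[OF Arr(3)]
      farr_hom[OF Arr(4)] farr_hom[OF Arr(5)] farr_hom[OF Arr(6)] nu1
      sigma[of d0 d0 D1 D0] sigma[of d0 d1 D2 D0] sigma[of d1 d1 D2 D1] nu0
    by (simp add: src_trg Delta3_relations sigma01_def sigma02_def sigma12_def)
qed

lemma lax_descent_pseudofunctor:
  assumes P: "pseudofunctor Delta3 K P" and L: "lax_descent_object K P L d \<psi>"
  shows "lax_descent K (fobj P 1) (fobj P 2) (fobj P 3) (farr P d0) (farr P d1) (farr P s0)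
    (farr P D0) (farr P D1) (farr P D2) (sigma01 K P) (sigma02 K P) (sigma12 K P) (nu0 K P)
    (inv2 K (nu1 K P)) L d \<psi>"
proof -
  interpret descent_diagram K "fobj P 1" "fobj P 2" "fobj P 3" "farr P d0" "farr P d1" "farr P s0"
    "farr P D0" "farr P D1" "farr P D2" "sigma01 K P" "sigma02 K P" "sigma12 K P" "nu0 K P"
    "inv2 K (nu1 K P)"
    by (rule descent_diagram_pseudofunctor[OF P])
  have datum: "datum F \<beta> = descent_datum K P F \<beta>" for F \<beta>
    by (simp only: datum_def descent_datum_def)
  show ?thesis
  proof unfold_locales
    show "datum d \<psi>" "d \<in> hom K L (fobj P 1)"
      using L unfolding lax_descent_object_def datum by blast+
  next
    fix F \<beta> T assume "datum F \<beta>" and F: "F \<in> hom K T (fobj P 1)"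
    then show "\<exists>!F'. F' \<in> hom K T L \<and> d \<cdot>\<^bsub>K\<^esub> F' = F \<and> \<psi> \<lhd>\<^bsub>K\<^esub> F' = \<beta>"
      using L homD(4)[OF F] unfolding lax_descent_object_def datum by blast
  next
    fix F\<^sub>1 T F\<^sub>0 \<xi>
    assume F: "F\<^sub>1 \<in> hom K T L" "F\<^sub>0 \<in> hom K T L" and "\<xi> \<in> cells K (d \<cdot>\<^bsub>K\<^esub> F\<^sub>1) (d \<cdot>\<^bsub>K\<^esub> F\<^sub>0)"
      "(\<psi> \<lhd>\<^bsub>K\<^esub> F\<^sub>0) \<bullet>\<^bsub>K\<^esub> (farr P d1 \<rhd>\<^bsub>K\<^esub> \<xi>) = (farr P d0 \<rhd>\<^bsub>K\<^esub> \<xi>) \<bullet>\<^bsub>K\<^esub> (\<psi> \<lhd>\<^bsub>K\<^esub> F\<^sub>1)"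
    then show "\<exists>!\<xi>'. \<xi>' \<in> cells K F\<^sub>1 F\<^sub>0 \<and> d \<rhd>\<^bsub>K\<^esub> \<xi>' = \<xi>"
      using L homD(4)[OF F(1)] unfolding lax_descent_object_def by blast
  qed
qed

theorem theorem2p4:
  fixes K :: "('o, 'a, 'c) two_cat"
    and P :: "(nat, ordmap, 'o, 'a, 'c) psfun"
    and L S B :: 'o and d J H :: 'a and \<psi> :: 'c
  assumes "two_category K"
    and "pseudofunctor Delta3 K P"
    and "lax_descent_object K P L d \<psi>"
    and "S \<in> Obj K" and "B \<in> Obj K"
    and "J \<in> hom K S L" and "H \<in> hom K S B"
  shows "((\<exists>E \<gamma>. is_ran K H (d \<cdot>\<^bsub>K\<^esub> J) E \<gamma> \<and>
             preserves_ran K (farr P d0) H (d \<cdot>\<^bsub>K\<^esub> J) E \<gamma> \<and>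
             preserves_ran K (farr P D0 \<cdot>\<^bsub>K\<^esub> farr P d0) H (d \<cdot>\<^bsub>K\<^esub> J) E \<gamma>)
           \<longrightarrow> creates_ran K d H J)
       \<and> ((\<exists>E \<eta>. is_lan K H (d \<cdot>\<^bsub>K\<^esub> J) E \<eta> \<and>
             preserves_lan K (farr P d1) H (d \<cdot>\<^bsub>K\<^esub> J) E \<eta> \<and>
             preserves_lan K (farr P D2 \<cdot>\<^bsub>K\<^esub> farr P d1) H (d \<cdot>\<^bsub>K\<^esub> J) E \<eta>)
           \<longrightarrow> creates_lan K d H J)"
proof -
  note lax = lax_descent_pseudofunctor[OF assms(2,3)]
  note lax_co = lax_descent.lax_descent_co[OF lax]
  show ?thesis
    using lax_descent.creates_ran_forgetful[OF lax assms(6,7)]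
      lax_descent.creates_ran_forgetful[OF lax_co, unfolded hom_co, OF assms(6,7)]
    by (auto simp: is_ran_co preserves_ran_co creates_ran_co)
qed

end
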